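(* The hypersimplex $\Delta_{4,2}$ has extension complexity $\mathrm{rk}_+(\Delta_{4,2})=6$, and the hypersimplices $\Delta_{5,2}\cong\Delta_{5,3}$ have extension complexity $\mathrm{rk}_+(\Delta_{5,2})=\mathrm{rk}_+(\Delta_{5,3})=9$. For all integers $n\ge 6$ and $2\le k\le n-2$ we have $\mathrm{rk}_+(\Delta_{n,k})=2n$.
   Context: For integers $0<k<n$, the $(n,k)$-hypersimplex is the convex polytope $\Delta_{n,k}=\mathrm{conv}\{x\in\{0,1\}^n : x_1+\cdots+x_n=k\}\subset\mathbb{R}^n$. The extension complexity (or nonnegative rank) $\mathrm{rk}_+(P)$ of a convex polytope $P$ is the minimal number of facets of a polytope $\widehat{P}$ (of any dimension, in any $\mathbb{R}^m$) such that $P$ is the image of $\widehat{P}$ under a linear projection (affine map). The symbol $\cong$ denotes affine isomorphism. *)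

theory Defs
  imports "HOL-Analysis.Analysis" "HOL-Analysis.Finite_Function_Topology"
begin

text \<open>
  The dimension of an extension of a polytope is not bounded in advance, so it cannot be fixed by
  a type. All polytopes here live in the real vector space of finitely supported sequences
  \<open>nat \<Rightarrow>\<^sub>0 real\<close>, in which \<open>\<real>\<^sup>m\<close> is the subspace of the sequences that are
  zero from index \<open>m\<close> on; the coordinates \<open>x_1, ..., x_m\<close> have the indices \<open>0, ..., m - 1\<close>.
\<close>

definition euclid :: "nat \<Rightarrow> (nat \<Rightarrow>\<^sub>0 real) set" where
  "euclid m = {x. Poly_Mapping.keys x \<subseteq> {..<m}}"

definition hypersimplex :: "nat \<Rightarrow> nat \<Rightarrow> (nat \<Rightarrow>\<^sub>0 real) set" where
  "hypersimplex n k = convex hull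
     {x \<in> euclid n. (\<forall>i<n. Poly_Mapping.lookup x i \<in> {0, 1}) \<and>
                    (\<Sum>i<n. Poly_Mapping.lookup x i) = real k}"

text \<open>
  The library's \<^const>\<open>aff_dim\<close> and \<^const>\<open>facet_of\<close> are restricted to the class
  \<^class>\<open>euclidean_space\<close>, to which \<open>nat \<Rightarrow>\<^sub>0 real\<close> does not belong. The next two definitions
  are the same for arbitrary real vector spaces; \<open>adim V\<close> is meaningful only when the affine hull
  of \<open>V\<close> is finite-dimensional.
\<close>

definition adim :: "'a::real_vector set \<Rightarrow> int" where
  "adim V = (SOME d. \<exists>B. finite B \<and> affine hull B = affine hull V \<and>
                         \<not> affine_dependent B \<and> of_nat (card B) = d + 1)"

definition facets :: "'a::real_vector set \<Rightarrow> 'a set set" where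
  "facets P = {F. F face_of P \<and> F \<noteq> {} \<and> adim F = adim P - 1}"

lemma adim_eq_aff_dim: "adim (V :: 'a::euclidean_space set) = aff_dim V"
proof -
  have "(\<exists>B. finite B \<and> affine hull B = affine hull V \<and> \<not> affine_dependent B \<and> int (card B) = d + 1) \<longleftrightarrow>
        (\<exists>B. affine hull B = affine hull V \<and> \<not> affine_dependent B \<and> int (card B) = d + 1)" for d
    using aff_independent_finite by blast
  then show ?thesis
    by (simp add: adim_def aff_dim_def)
qed

lemma facets_eq_facet_of: "facets (P :: 'a::euclidean_space set) = {F. F facet_of P}"
  by (simp add: facets_def facet_of_def adim_eq_aff_dim)

lemma face_of_convex_hull_finite:
  fixes V :: "'a::real_vector set"
  assumes "finite V" "F face_of convex hull V"
  shows "F = convex hull (F \<inter> V)"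
proof
  have "x \<in> convex hull (F \<inter> V)" if "F face_of convex hull V" "x \<in> F" for x F
    using assms(1) that
  proof (induction V arbitrary: x F rule: finite_induct)
    case empty
    then show ?case by (auto simp: face_of_def)
  next
    case (insert a V)
    show ?case
    proof (cases "V = {}")
      case True
      then have "x = a"
        using insert.prems face_of_imp_subset by fastforce
      then show ?thesis
        using insert.prems by (simp add: hull_inc)
    next
      case False
      have sub: "convex hull V \<subseteq> convex hull (insert a V)"
        by (simp add: hull_mono subset_insertI)
      have "x \<in> convex hull (insert a V)"
        using insert.prems face_of_imp_subset by blast
      then obtain s t y where st: "s \<ge> 0" "t \<ge> 0" "s + t = 1" and y: "y \<in> convex hull V"
        and x: "x = s *\<^sub>R a + t *\<^sub>R y"
        using convex_hull_insert[OF False, of a] by auto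
      have face: "(F \<inter> convex hull V) face_of convex hull V"
        using insert.prems(1) sub
        by (metis Int_commute Int_absorb1 convex_convex_hull face_of_Int_subface face_of_refl
            face_of_slice inf.commute)
      have IH: "y \<in> convex hull (F \<inter> insert a V)" if "y \<in> F"
      proof -
        have "y \<in> convex hull (F \<inter> convex hull V \<inter> V)"
          using insert.IH[OF face] that y by blast
        then show ?thesis
          by (rule subsetD[OF hull_mono, rotated]) auto
      qed
      consider "s = 0" | "x = a" | "s > 0" "t > 0" "a \<noteq> y"
      proof (cases "s = 0 \<or> t = 0 \<or> a = y")
        case True
        moreover have "x = a" if "t = 0" using that st x by simp
        moreover have "x = a" if "a = y" using that st x by (simp flip: scaleR_left_distrib)
        ultimately show ?thesis using that by blast
      next
        case False
        then show ?thesis using st that by simp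
      qed
      then show ?thesis
      proof cases
        case 1
        then show ?thesis using IH x st insert.prems by simp
      next
        case 2
        then show ?thesis using insert.prems by (simp add: hull_inc)
      next
        case 3
        then have "x \<in> open_segment a y"
          unfolding in_segment using x st by (intro conjI exI[of _ t]) (simp_all flip: eq_diff_eq)
        moreover have "a \<in> convex hull (insert a V)" "y \<in> convex hull (insert a V)"
          using y sub by (auto simp: hull_inc)
        ultimately have aF: "a \<in> F" and yF: "y \<in> F"
          using insert.prems by (auto dest: face_ofD)
        have "a \<in> convex hull (F \<inter> insert a V)"
          using aF by (simp add: hull_inc)
        then show ?thesis
          using convexD[OF convex_convex_hull _ IH[OF yF]] x st by blast
      qed
    qed
  qed
  then show "F \<subseteq> convex hull (F \<inter> V)"
    using assms(2) by blast
  show "convex hull (F \<inter> V) \<subseteq> F"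
    using face_of_imp_convex[OF assms(2)] by (simp add: hull_minimal)
qed

lemma finite_facets:
  assumes "polytope P"
  shows "finite (facets P)"
proof -
  obtain V where V: "finite V" "P = convex hull V"
    using assms by (auto simp: polytope_def)
  have "facets P \<subseteq> (\<lambda>W. convex hull W) ` Pow V"
  proof
    fix F assume "F \<in> facets P"
    then have "F = convex hull (F \<inter> V)"
      using face_of_convex_hull_finite[OF V(1)] V(2) unfolding facets_def by blast
    then show "F \<in> (\<lambda>W. convex hull W) ` Pow V"
      by blast
  qed
  then show ?thesis
    using V(1) finite_surj by blast
qed

definition affine_map :: "('a::real_vector \<Rightarrow> 'b::real_vector) \<Rightarrow> bool" where
  "affine_map f \<longleftrightarrow> (\<exists>A b. linear A \<and> f = (\<lambda>x. A x + b))"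

text \<open>The affine map is only required to be bijective between the two polytopes, which need not be
  full-dimensional in their ambient spaces.\<close>

definition affinely_isomorphic :: "'a::real_vector set \<Rightarrow> 'b::real_vector set \<Rightarrow> bool"  (infix "\<cong>\<^sub>a" 50) where
  "P \<cong>\<^sub>a Q \<longleftrightarrow> (\<exists>f. affine_map f \<and> bij_betw f P Q)"

definition extension_of :: "(nat \<Rightarrow>\<^sub>0 real) set \<Rightarrow> 'a::real_vector set \<Rightarrow> bool" where
  "extension_of Q P \<longleftrightarrow> polytope Q \<and> (\<exists>m. Q \<subseteq> euclid m) \<and> (\<exists>f. affine_map f \<and> f ` Q = P)"

definition rk_plus :: "'a::real_vector set \<Rightarrow> nat" where
  "rk_plus P = (LEAST N. \<exists>Q. extension_of Q P \<and> card (facets Q) = N)"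

lemma polytope_hypersimplex: "polytope (hypersimplex n k)"
proof -
  let ?S = "{x \<in> euclid n. (\<forall>i<n. Poly_Mapping.lookup x i \<in> {0, 1}) \<and>
                          (\<Sum>i<n. Poly_Mapping.lookup x i) = real k}"
  have "inj_on Poly_Mapping.keys ?S"
  proof (rule inj_onI)
    fix x y assume xy: "x \<in> ?S" "y \<in> ?S" and keys: "Poly_Mapping.keys x = Poly_Mapping.keys y"
    show "x = y"
    proof (rule poly_mapping_eqI)
      fix i
      have 0: "Poly_Mapping.lookup x i = 0 \<longleftrightarrow> Poly_Mapping.lookup y i = 0"
        using keys by (metis in_keys_iff)
      show "Poly_Mapping.lookup x i = Poly_Mapping.lookup y i"
      proof (cases "i < n")
        case True
        then show ?thesis using 0 xy by (smt (verit) insertE mem_Collect_eq singletonD)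
      next
        case False
        then have "i \<notin> Poly_Mapping.keys x"
          using xy by (auto simp: euclid_def)
        then show ?thesis using 0 by (simp add: in_keys_iff)
      qed
    qed
  qed
  moreover have "Poly_Mapping.keys ` ?S \<subseteq> Pow {..<n}"
    by (auto simp: euclid_def)
  ultimately have "finite ?S"
    by (meson finite_Pow_iff finite_lessThan inj_on_finite)
  then show ?thesis
    unfolding polytope_def hypersimplex_def by blast
qed

lemma hypersimplex_subset_euclid: "hypersimplex n k \<subseteq> euclid n"
proof -
  have "convex (euclid n)"
  proof (rule convexI)
    fix x y u v assume "x \<in> euclid n" "y \<in> euclid n"
    then have "Poly_Mapping.keys (u *\<^sub>R x) \<subseteq> {..<n}" "Poly_Mapping.keys (v *\<^sub>R y) \<subseteq> {..<n}"
      by (auto simp: euclid_def in_keys_iff subset_iff scaleR_poly_mapping_def)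
    then show "u *\<^sub>R x + v *\<^sub>R y \<in> euclid n"
      using keys_add[of "u *\<^sub>R x" "v *\<^sub>R y"] by (auto simp: euclid_def)
  qed
  then show ?thesis
    unfolding hypersimplex_def by (intro hull_minimal) auto
qed

lemma rk_plus_hypersimplex_attained:
  "\<exists>Q. extension_of Q (hypersimplex n k) \<and> card (facets Q) = rk_plus (hypersimplex n k)"
proof -
  have "affine_map (\<lambda>x :: nat \<Rightarrow>\<^sub>0 real. x)"
    unfolding affine_map_def by (intro exI[of _ "\<lambda>x. x"] exI[of _ 0]) (simp add: linear_iff)
  then have "extension_of (hypersimplex n k) (hypersimplex n k)"
    unfolding extension_of_def
    using polytope_hypersimplex hypersimplex_subset_euclid by (metis image_ident)
  then show ?thesis
    unfolding rk_plus_def by (rule_tac LeastI_ex) blast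
qed

end

theory Submission
  imports Defs
begin

text \<open>By Yannakakis' theorem an extension with \<open>N\<close> facets yields a nonnegative factorization of the
  slack matrix with \<open>N\<close> rank-one terms. Restricting to the facet \<open>x_i = 0\<close> kills all terms that meet the row
  of \<open>x_i \<ge> 0\<close>, and complementation does the same for \<open>x_i \<le> 1\<close>. So if some row meets at least three
  terms, then the bound follows by induction on \<open>n\<close>, since the numbers 3, 6, 9, 12, 14, 16, ... grow by
  at most three. If all rows meet at most two terms, then the terms can be counted directly: for
  \<open>3 \<le> k \<le> n - 3\<close> by double counting, and for \<open>k = 2\<close> by double counting together with a rank bound.
  Equality for \<open>(4, 2)\<close> comes from the simplex with six vertices, for \<open>(5, 2)\<close> from an explicit
  six-dimensional polytope with nine facets, and in the remaining cases from the hypersimplex itself.\<close>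

text \<open>The two facets of a coordinate behave differently. For 3 <= k <= n - 3 both
  \<open>x_i = 0\<close> and \<open>x_i = 1\<close> are hypersimplices within the range of the
  induction, so every row may be assumed light; since any three coordinates of a vertex can be
  prescribed, a row without a term of its own is then split in a rigid way. For k = 2 the facet
  \<open>x_i = 1\<close> is a simplex, about which the induction says nothing. Only the rows
  \<open>x_i >= 0\<close> are then controlled, and the terms that meet none of them have to be
  bounded from below by other means; this is where the rank enters. The induction for k = 2 starts
  at the triangle, n = 3, with bound three. Increments of three lead from there to 2n exactly at n =
  6, which is the origin of the exceptional values 6 and 9.\<close>

subsection \<open>Nonnegative factorizations of slack matrices\<close>

text \<open>A nonnegative factorization of the slack matrix of the hypersimplex on the ground set \<open>S\<close>,
  with rank-one terms indexed by \<open>R\<close>. The columns are the \<open>k\<close>-subsets \<open>v\<close> of \<open>S\<close>; the coefficients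
  \<open>a\<close> and \<open>b\<close> belong to the rows \<open>x_i \<ge> 0\<close> and \<open>x_i \<le> 1\<close>.\<close>

definition slack_factorization ::
    "nat set \<Rightarrow> nat \<Rightarrow> 'r set \<Rightarrow> ('r \<Rightarrow> nat \<Rightarrow> real) \<Rightarrow> ('r \<Rightarrow> nat \<Rightarrow> real) \<Rightarrow> ('r \<Rightarrow> nat set \<Rightarrow> real) \<Rightarrow> bool"
  where "slack_factorization S k R a b h \<longleftrightarrow> finite S \<and> finite R \<and>
    (\<forall>r\<in>R. \<forall>i\<in>S. 0 \<le> a r i \<and> 0 \<le> b r i) \<and>
    (\<forall>v\<subseteq>S. card v = k \<longrightarrow> (\<forall>r\<in>R. 0 \<le> h r v) \<and>
       (\<forall>i\<in>S. (\<Sum>r\<in>R. a r i * h r v) = of_bool (i \<in> v) \<and>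
               (\<Sum>r\<in>R. b r i * h r v) = of_bool (i \<notin> v)))"

lemma slack_factorizationD:
  assumes "slack_factorization S k R a b h"
  shows "finite S" "finite R"
    "\<And>r i. r \<in> R \<Longrightarrow> i \<in> S \<Longrightarrow> 0 \<le> a r i" "\<And>r i. r \<in> R \<Longrightarrow> i \<in> S \<Longrightarrow> 0 \<le> b r i"
    "\<And>v r. v \<subseteq> S \<Longrightarrow> card v = k \<Longrightarrow> r \<in> R \<Longrightarrow> 0 \<le> h r v"
    "\<And>v i. v \<subseteq> S \<Longrightarrow> card v = k \<Longrightarrow> i \<in> S \<Longrightarrow> (\<Sum>r\<in>R. a r i * h r v) = of_bool (i \<in> v)"
    "\<And>v i. v \<subseteq> S \<Longrightarrow> card v = k \<Longrightarrow> i \<in> S \<Longrightarrow> (\<Sum>r\<in>R. b r i * h r v) = of_bool (i \<notin> v)"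
  using assms unfolding slack_factorization_def by blast+

text \<open>The reflection \<open>x_i -> 1 - x_i\<close> exchanges the two kinds of rows.\<close>

lemma slack_factorization_complement:
  assumes "slack_factorization S k R a b h" "k \<le> card S"
  shows "slack_factorization S (card S - k) R b a (\<lambda>r v. h r (S - v))"
proof -
  note f = slack_factorizationD[OF assms(1)]
  have c: "card (S - v) = k" if "v \<subseteq> S" "card v = card S - k" for v
    using that assms(2) card_Diff_subset[of v S] finite_subset[OF that(1) f(1)] by simp
  show ?thesis
    unfolding slack_factorization_def
  proof (intro conjI ballI allI impI)
    fix v assume v: "v \<subseteq> S" "card v = card S - k"
    { fix r assume "r \<in> R"
      then show "0 \<le> h r (S - v)" using f(5) c[OF v] by blast }
    fix i assume i: "i \<in> S"
    show "(\<Sum>r\<in>R. b r i * h r (S - v)) = of_bool (i \<in> v)"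
      "(\<Sum>r\<in>R. a r i * h r (S - v)) = of_bool (i \<notin> v)"
      using f(6,7)[OF Diff_subset c[OF v] i] i by auto
  qed (use f in auto)
qed

text \<open>Common core of restricting to a facet and of pruning: terms that vanish on all remaining
  columns do not change any sum.\<close>

lemma slack_factorization_subset:
  assumes fac: "slack_factorization S k R a b h" and sub: "S' \<subseteq> S" "R' \<subseteq> R"
    and dead: "\<And>r v. r \<in> R - R' \<Longrightarrow> v \<subseteq> S' \<Longrightarrow> card v = k \<Longrightarrow> h r v = 0"
  shows "slack_factorization S' k R' a b h"
proof -
  note f = slack_factorizationD[OF fac]
  have sum_eq: "(\<Sum>r\<in>R'. c r * h r v) = (\<Sum>r\<in>R. c r * h r v)"
    if v: "v \<subseteq> S'" "card v = k" for c :: "'a \<Rightarrow> real" and v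
    by (rule sum.mono_neutral_left) (use f(2) sub dead[OF _ v] in auto)
  show ?thesis
    unfolding slack_factorization_def
  proof (intro conjI ballI allI impI)
    show "finite S'" "finite R'" using f(1,2) sub finite_subset by blast+
    fix v assume v: "v \<subseteq> S'" "card v = k"
    then have v': "v \<subseteq> S" using sub by blast
    { fix r assume "r \<in> R'"
      then show "0 \<le> h r v" using f(5) v(2) v' sub by blast }
    fix j assume j: "j \<in> S'"
    then show "(\<Sum>r\<in>R'. a r j * h r v) = of_bool (j \<in> v)"
      "(\<Sum>r\<in>R'. b r j * h r v) = of_bool (j \<notin> v)"
      unfolding sum_eq[OF v] using f(6,7)[OF v' v(2)] sub by blast+
  qed (use f(3,4) sub in blast)+
qed

text \<open>On vertices avoiding \<open>i\<close> the row \<open>x_i >= 0\<close> is zero, so each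
  of its nonnegative summands is zero, and a term with a positive coefficient there must
  vanish.\<close>

lemma slack_factorization_facet:
  assumes fac: "slack_factorization S k R a b h" and i: "i \<in> S"
  shows "slack_factorization (S - {i}) k {r \<in> R. \<not> 0 < a r i} a b h"
proof (rule slack_factorization_subset[OF fac])
  note f = slack_factorizationD[OF fac]
  fix r v assume r: "r \<in> R - {r \<in> R. \<not> 0 < a r i}" and v: "v \<subseteq> S - {i}" "card v = k"
  then have v': "v \<subseteq> S" by blast
  have "(\<Sum>r\<in>R. a r i * h r v) = 0"
    using f(6)[OF v' v(2) i] v(1) by auto
  then have "\<forall>r\<in>R. a r i * h r v = 0"
    using f(2,3,5) i v' v(2) by (subst (asm) sum_nonneg_eq_0_iff) auto
  then show "h r v = 0" using r by auto
qed auto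

lemma slack_factorization_prune:
  assumes fac: "slack_factorization S k R a b h"
  shows "slack_factorization S k {r \<in> R. \<exists>v\<subseteq>S. card v = k \<and> 0 < h r v} a b h"
proof (rule slack_factorization_subset[OF fac])
  fix r v assume "r \<in> R - {r \<in> R. \<exists>v\<subseteq>S. card v = k \<and> 0 < h r v}" "v \<subseteq> S" "card v = k"
  then have "r \<in> R" "\<not> 0 < h r v" "0 \<le> h r v"
    using slack_factorizationD(5)[OF fac, of v r] by blast+
  then show "h r v = 0" by linarith
qed auto

section \<open>Unit vectors and the rank bound\<close>

abbreviation unit_vec :: "nat \<Rightarrow> (nat \<Rightarrow>\<^sub>0 real)"
  where "unit_vec i \<equiv> Poly_Mapping.single i 1"

lemma lookup_scaleR [simp]:
  "Poly_Mapping.lookup (c *\<^sub>R x) i = c * Poly_Mapping.lookup (x :: nat \<Rightarrow>\<^sub>0 real) i"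
  by (simp add: scaleR_poly_mapping_def)

lemma linear_lookup: "linear (\<lambda>x :: nat \<Rightarrow>\<^sub>0 real. Poly_Mapping.lookup x i)"
  by (rule linearI) (simp_all add: lookup_add)

lemma inj_unit_vec: "inj unit_vec"
proof (rule injI)
  fix i j assume "unit_vec i = unit_vec j"
  then have "Poly_Mapping.lookup (unit_vec i) i = Poly_Mapping.lookup (unit_vec j) i" by simp
  then show "i = j" by (simp add: lookup_single when_def split: if_splits)
qed

lemma independent_unit_vecs: "independent (unit_vec ` C)"
proof
  assume "dependent (unit_vec ` C)"
  then obtain e where e: "e \<in> C" "unit_vec e \<in> span (unit_vec ` C - {unit_vec e})"
    unfolding dependent_def by auto
  have sp: "subspace {x :: nat \<Rightarrow>\<^sub>0 real. Poly_Mapping.lookup x e = 0}"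
    by (auto simp: subspace_def lookup_add)
  have "Poly_Mapping.lookup x e = 0" if "x \<in> span (unit_vec ` C - {unit_vec e})" for x
    using that sp by (rule span_induct) (auto simp: lookup_single when_def)
  from this[OF e(2)] show False by simp
qed

text \<open>Signs play no role: the matrix with entries \<open>[d \<notin> v]\<close> has rank \<open>card C\<close>.\<close>

lemma card_le_of_factorization:
  fixes b :: "'r \<Rightarrow> nat \<Rightarrow> real"
  assumes "finite C" "finite Z" "1 \<le> k" "k < card C"
    and fac: "\<And>v d. v \<subseteq> C \<Longrightarrow> card v = k \<Longrightarrow> d \<in> C \<Longrightarrow> (\<Sum>r\<in>Z. b r d * h r v) = of_bool (d \<notin> v)"
  shows "card C \<le> card Z"
proof -
  \<comment> \<open>\<open>w v\<close> is the column of \<open>v\<close>. The factorization writes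
    it in terms of the vectors \<open>u r\<close>, so \<open>card Z\<close> vectors span all
    columns.\<close>
  define w where "w v = (\<Sum>d\<in>C. of_bool (d \<notin> v) *\<^sub>R unit_vec d)" for v
  define u where "u r = (\<Sum>d\<in>C. b r d *\<^sub>R unit_vec d)" for r
  let ?W = "span (u ` Z)"
  have w_in: "w v \<in> ?W" if "v \<subseteq> C" "card v = k" for v
  proof -
    have "w v = (\<Sum>d\<in>C. (\<Sum>r\<in>Z. b r d * h r v) *\<^sub>R unit_vec d)"
      unfolding w_def by (intro sum.cong refl) (simp add: fac[OF that])
    also have "\<dots> = (\<Sum>r\<in>Z. h r v *\<^sub>R u r)"
      unfolding u_def scaleR_sum_left scaleR_sum_right by (subst sum.swap) (simp add: mult.commute)
    also have "\<dots> \<in> ?W" by (intro span_sum span_scale span_base) auto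
    finally show ?thesis .
  qed
  \<comment> \<open>Two vertices that differ by exchanging \<open>i\<close> and \<open>j\<close>
    have columns with this difference; their common part has \<open>k - 1\<close> elements, whence
    \<open>1 <= k\<close>.\<close>
  have diff: "unit_vec i - unit_vec j \<in> ?W" if ij: "i \<in> C" "j \<in> C" for i j
  proof (cases "i = j")
    case False
    have "k - 1 \<le> card (C - {i,j})" using assms ij False by (simp add: card_Diff_subset)
    then obtain t where t: "t \<subseteq> C - {i,j}" "card t = k - 1" "finite t"
      by (rule obtain_subset_with_card_n)
    have 1: "insert j t \<subseteq> C" "insert i t \<subseteq> C" using t ij by auto
    have 2: "card (insert j t) = k" "card (insert i t) = k"
      using t assms by (subst card_insert_disjoint; auto)+
    have "w (insert j t) - w (insert i t) =
        (\<Sum>d\<in>C. (of_bool (d = i) - of_bool (d = j)) *\<^sub>R unit_vec d)"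
      unfolding w_def sum_subtractf[symmetric] scaleR_left_diff_distrib[symmetric]
      using t ij False by (intro sum.cong refl) auto
    also have "\<dots> = unit_vec i - unit_vec j"
    proof -
      have "(\<Sum>d\<in>C. of_bool (d = l) *\<^sub>R unit_vec d) = unit_vec l" if "l \<in> C" for l
        using that assms(1) by (subst sum.remove[of _ l]) (auto intro!: sum.neutral)
      then show ?thesis using ij by (simp add: scaleR_left_diff_distrib sum_subtractf)
    qed
    finally show ?thesis using w_in[OF 1(1) 2(1)] w_in[OF 1(2) 2(2)] span_diff by metis
  qed (simp add: span_zero)
  \<comment> \<open>Modulo differences of unit vectors every column is \<open>unit_vec i\<close>
    times \<open>card C - k\<close>, which is nonzero as \<open>k < card C\<close>.\<close>
  have "unit_vec i \<in> ?W" if i: "i \<in> C" for i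
  proof -
    obtain t where t: "t \<subseteq> C" "card t = k" "finite t"
      using obtain_subset_with_card_n[of k C] assms by auto
    have "w t = (\<Sum>d\<in>C - t. unit_vec d)"
      unfolding w_def using assms(1) by (intro sum.mono_neutral_cong_right) auto
    also have "\<dots> = (\<Sum>d\<in>C - t. unit_vec i) + (\<Sum>d\<in>C - t. unit_vec d - unit_vec i)"
      unfolding sum.distrib[symmetric] by simp
    also have "\<dots> = real (card C - k) *\<^sub>R unit_vec i + (\<Sum>d\<in>C - t. unit_vec d - unit_vec i)"
      using t by (simp only: sum_constant_scaleR card_Diff_subset)
    finally have eq: "real (card C - k) *\<^sub>R unit_vec i = w t - (\<Sum>d\<in>C - t. unit_vec d - unit_vec i)"
      by simp
    have "real (card C - k) *\<^sub>R unit_vec i \<in> ?W"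
      unfolding eq using t i by (intro span_diff span_sum w_in diff) auto
    then have "(1 / real (card C - k)) *\<^sub>R (real (card C - k) *\<^sub>R unit_vec i) \<in> ?W"
      by (rule span_scale)
    then show ?thesis using assms(4) by simp
  qed
  then have "unit_vec ` C \<subseteq> ?W" by auto
  then have "card (unit_vec ` C) \<le> card (u ` Z)"
    using independent_span_bound[OF finite_imageI[OF assms(2)] independent_unit_vecs] by blast
  also have "card (unit_vec ` C) = card C"
    using inj_unit_vec by (simp add: card_image inj_on_subset)
  finally show ?thesis using card_image_le[OF assms(2)] le_trans by blast
qed

section \<open>Supports of the rank-one terms\<close>

locale reduced_factorization =
  fixes S :: "nat set" and k :: nat and R :: "'r set" and a b :: "'r \<Rightarrow> nat \<Rightarrow> real"
    and h :: "'r \<Rightarrow> nat set \<Rightarrow> real"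
  assumes fac: "slack_factorization S k R a b h"
    and alive: "r \<in> R \<Longrightarrow> \<exists>v\<subseteq>S. card v = k \<and> 0 < h r v"
begin

text \<open>Only the supports of the coefficients are kept. By \<open>alive\<close>, each term has a
  vertex that contains \<open>A r\<close> and avoids \<open>B r\<close>, so a term acts as a partial
  assignment of coordinates, and the factorization as a cover of the nonzero slacks by such
  assignments.\<close>

definition A where "A r = {i \<in> S. 0 < a r i}"
definition B where "B r = {i \<in> S. 0 < b r i}"
definition vertex where "vertex v \<longleftrightarrow> v \<subseteq> S \<and> card v = k"

lemmas facD = slack_factorizationD[OF fac, folded vertex_def]

lemma vertexD: "vertex v \<Longrightarrow> v \<subseteq> S" "vertex v \<Longrightarrow> finite v"
  using facD(1) finite_subset by (auto simp: vertex_def)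

lemma alive_vertex: "r \<in> R \<Longrightarrow> \<exists>v. vertex v \<and> 0 < h r v"
  using alive by (auto simp: vertex_def)

lemma A_subset:
  assumes "vertex v" "r \<in> R" "0 < h r v" shows "A r \<subseteq> v"
proof
  fix i assume i: "i \<in> A r"
  then have "i \<in> S" "0 < a r i * h r v" using assms by (auto simp: A_def)
  moreover have "a r i * h r v \<le> (\<Sum>r\<in>R. a r i * h r v)"
    using assms facD(2,3,5) \<open>i \<in> S\<close> by (intro member_le_sum) (auto simp: vertex_def)
  ultimately show "i \<in> v" using facD(6)[of v i] assms by (cases "i \<in> v") (auto simp: vertex_def)
qed

lemma B_disjoint:
  assumes "vertex v" "r \<in> R" "0 < h r v" shows "B r \<inter> v = {}"
proof -
  have "i \<notin> v" if i: "i \<in> B r" for i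
  proof -
    have "i \<in> S" "0 < b r i * h r v" using assms i by (auto simp: B_def)
    moreover have "b r i * h r v \<le> (\<Sum>r\<in>R. b r i * h r v)"
      using assms facD(2,4,5) \<open>i \<in> S\<close> by (intro member_le_sum) (auto simp: vertex_def)
    ultimately show "i \<notin> v" using facD(7)[of v i] assms by (cases "i \<in> v") (auto simp: vertex_def)
  qed
  then show ?thesis by blast
qed

lemma sum_pos_ex:
  fixes f :: "'r \<Rightarrow> real"
  assumes "0 < (\<Sum>r\<in>R. f r)" shows "\<exists>r\<in>R. 0 < f r"
  using assms sum_nonpos[of R f] by force

lemma cover_A:
  assumes "vertex v" "i \<in> v" obtains r where "r \<in> R" "0 < h r v" "i \<in> A r"
proof -
  have i: "i \<in> S" using assms vertexD by blast
  have "0 < (\<Sum>r\<in>R. a r i * h r v)" using facD(6)[of v i] i assms by (simp add: vertex_def)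
  then obtain r where "r \<in> R" "0 < a r i * h r v" using sum_pos_ex by blast
  then have "0 < a r i \<and> 0 < h r v"
    using facD(3)[of r i] facD(5)[of v r] i assms(1) unfolding vertex_def
    by (simp add: zero_less_mult_iff)
  then show ?thesis using \<open>r \<in> R\<close> i that by (auto simp: A_def)
qed

lemma cover_B:
  assumes "vertex v" "i \<in> S" "i \<notin> v" obtains r where "r \<in> R" "0 < h r v" "i \<in> B r"
proof -
  have "0 < (\<Sum>r\<in>R. b r i * h r v)" using facD(7)[of v i] assms by (simp add: vertex_def)
  then obtain r where "r \<in> R" "0 < b r i * h r v" using sum_pos_ex by blast
  then have "0 < b r i \<and> 0 < h r v"
    using facD(4)[of r i] facD(5)[of v r] assms unfolding vertex_def
    by (simp add: zero_less_mult_iff)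
  then show ?thesis using \<open>r \<in> R\<close> assms that by (auto simp: B_def)
qed

lemma finite_A: "finite (A r)" and finite_B: "finite (B r)"
  using facD(1) by (auto simp: A_def B_def)

definition F where "F i = {r \<in> R. i \<in> A r}"
definition G where "G i = {r \<in> R. i \<in> B r}"

lemma finite_F: "finite (F i)" and finite_G: "finite (G i)"
  using facD(2) by (auto simp: F_def G_def)

lemma vertex_exists:
  assumes "T \<subseteq> S" "U \<subseteq> S" "T \<inter> U = {}" "card T \<le> k" "card U + k \<le> card S"
  shows "\<exists>v. vertex v \<and> T \<subseteq> v \<and> v \<inter> U = {}"
proof -
  note fin = finite_subset[OF assms(1) facD(1)] finite_subset[OF assms(2) facD(1)]
  have "card (S - (T \<union> U)) = card S - (card T + card U)"
    using assms fin by (simp add: card_Diff_subset card_Un_disjoint)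
  then have "k - card T \<le> card (S - (T \<union> U))" using assms by linarith
  then obtain w where w: "w \<subseteq> S - (T \<union> U)" "card w = k - card T" "finite w"
    by (rule obtain_subset_with_card_n)
  have "card (T \<union> w) = k" using w assms fin by (subst card_Un_disjoint) auto
  then show ?thesis using w assms by (intro exI[of _ "T \<union> w"]) (auto simp: vertex_def)
qed

text \<open>The engine of the induction: passing to \<open>x_i = 0\<close> loses all of
  \<open>F i\<close> at once. The bound \<open>m\<close> is assumed for every set of remaining terms
  so that an induction hypothesis fits.\<close>

lemma F_facet_bound:
  assumes "i \<in> S"
    and "\<And>R'. R' \<subseteq> R \<Longrightarrow> slack_factorization (S - {i}) k R' a b h \<Longrightarrow> m \<le> card R'"
  shows "m + card (F i) \<le> card R"
proof -
  have eq: "{r \<in> R. \<not> 0 < a r i} = R - F i" using assms(1) by (auto simp: F_def A_def)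
  have "m \<le> card (R - F i)"
    using slack_factorization_facet[OF fac assms(1)] assms(2)[of "R - F i"] unfolding eq by blast
  moreover have "card (R - F i) = card R - card (F i)" "card (F i) \<le> card R"
    using facD(2) by (auto simp: F_def intro!: card_Diff_subset card_mono)
  ultimately show ?thesis by linarith
qed

text \<open>Lets the rows \<open>x_i <= 1\<close> be treated as rows \<open>x_i >= 0\<close> of the
  complement, so that \<open>F_facet_bound\<close> covers both.\<close>

lemma reduced_complement:
  assumes "k \<le> card S"
  shows "reduced_factorization S (card S - k) R b a (\<lambda>r v. h r (S - v))"
proof
  show "slack_factorization S (card S - k) R b a (\<lambda>r v. h r (S - v))"
    using slack_factorization_complement[OF fac assms] .
  fix r assume "r \<in> R"
  then obtain v where v: "v \<subseteq> S" "card v = k" "0 < h r v" using alive by blast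
  have "S - (S - v) = v" using v by blast
  then show "\<exists>v\<subseteq>S. card v = card S - k \<and> 0 < h r (S - v)"
    using v facD(1) by (intro exI[of _ "S - v"]) (simp add: card_Diff_subset finite_subset)
qed

text \<open>A pair \<open>(i, s)\<close> stands for the inequality \<open>x_i \<ge> 0\<close> if \<open>s\<close> holds, and for
  \<open>x_i \<le> 1\<close> otherwise. If no row of the factorization meets three rank-one terms, then a row
  without a term of its own is split by exactly two terms, each of which is shared by two rows.\<close>

lemma card_ge_if_rows_le_two:
  assumes k: "3 \<le> k" "k + 3 \<le> card S"
    and le2: "\<And>i. i \<in> S \<Longrightarrow> card (F i) \<le> 2" "\<And>i. i \<in> S \<Longrightarrow> card (G i) \<le> 2"
  shows "2 * card S \<le> card R"
proof -
  \<comment> \<open>\<open>sat v l\<close> says that the slack of row \<open>l\<close> at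
    \<open>v\<close> is one. A term is alive only on vertices that satisfy all of
    \<open>L r\<close>, and if \<open>sat v l\<close> holds, some term of \<open>row l\<close> is
    alive at \<open>v\<close>.\<close>
  define L where "L r = A r \<times> {True} \<union> B r \<times> {False}" for r
  define row where "row l = {r \<in> R. l \<in> L r}" for l
  define sat where "sat v l \<longleftrightarrow> (fst l \<in> v) = snd l" for v :: "nat set" and l :: "nat \<times> bool"
  define neg where "neg l = (fst l, \<not> snd l)" for l :: "nat \<times> bool"
  have neg_neg [simp]: "neg (neg l) = l" for l by (simp add: neg_def)
  have sat_neg [simp]: "sat v (neg l) \<longleftrightarrow> \<not> sat v l" for v l by (auto simp: sat_def neg_def)
  have L_sub: "L r \<subseteq> S \<times> UNIV" for r by (auto simp: L_def A_def B_def)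
  have sat_alive: "sat v l" if "vertex v" "r \<in> R" "0 < h r v" "l \<in> L r" for v r l
    using A_subset[OF that(1-3)] B_disjoint[OF that(1-3)] that(4) by (auto simp: L_def sat_def)
  have cover: "\<exists>r\<in>row l. 0 < h r v" if "vertex v" "l \<in> S \<times> UNIV" "sat v l" for v l
  proof (cases "snd l")
    case True
    then have "fst l \<in> v" using that by (simp add: sat_def)
    with that(1) obtain r where "r \<in> R" "0 < h r v" "fst l \<in> A r" by (rule cover_A)
    with True show ?thesis by (auto simp: row_def L_def intro!: bexI[of _ r])
        (metis (full_types) mem_Sigma_iff prod.collapse singletonI)
  next
    case False
    then have "fst l \<notin> v" "fst l \<in> S" using that by (auto simp: sat_def)
    with that(1) obtain r where "r \<in> R" "0 < h r v" "fst l \<in> B r" using cover_B by metis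
    with False show ?thesis by (auto simp: row_def L_def intro!: bexI[of _ r])
        (metis (full_types) mem_Sigma_iff prod.collapse singletonI)
  qed
  \<comment> \<open>Three requirements of the same kind need \<open>3 <= k\<close> or
    \<open>k + 3 <= card S\<close>.\<close>
  have satisfiable: "\<exists>v. vertex v \<and> (\<forall>l\<in>Q. sat v l)"
    if Q: "finite Q" "card Q \<le> 3" "Q \<subseteq> S \<times> UNIV" "\<And>l. l \<in> Q \<Longrightarrow> neg l \<notin> Q" for Q
  proof -
    let ?T = "fst ` {l \<in> Q. snd l}" and ?U = "fst ` {l \<in> Q. \<not> snd l}"
    have "card ?T \<le> card {l \<in> Q. snd l}" "card ?U \<le> card {l \<in> Q. \<not> snd l}"
      using Q(1) by (auto intro!: card_image_le)
    moreover have "card {l \<in> Q. snd l} \<le> card Q" "card {l \<in> Q. \<not> snd l} \<le> card Q"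
      using Q(1) by (auto intro!: card_mono)
    ultimately have c: "card ?T \<le> k" "card ?U + k \<le> card S" using Q(2) k by linarith+
    have disj: "?T \<inter> ?U = {}" using Q(4) by (force simp: neg_def)
    have "?T \<subseteq> S" "?U \<subseteq> S" using Q(3) by auto
    from vertex_exists[OF this disj c] obtain v where v: "vertex v" "?T \<subseteq> v" "v \<inter> ?U = {}" by blast
    have "sat v l" if "l \<in> Q" for l
      using v(2,3) that by (cases "snd l") (auto simp: sat_def)
    with v(1) show ?thesis by blast
  qed
  have row_le: "card (row l) \<le> 2" if "l \<in> S \<times> UNIV" for l
  proof -
    have "row l = (if snd l then F (fst l) else G (fst l))"
      by (cases l) (auto simp: row_def F_def G_def L_def)
    then show ?thesis using le2 that by (auto split: if_splits)
  qed
  have fin_row: "finite (row l)" for l using facD(2) by (simp add: row_def)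
  have row_cases: "(\<exists>r\<in>row l. L r = {l}) \<or>
      (\<exists>r1 r2. r1 \<noteq> r2 \<and> r1 \<in> row l \<and> r2 \<in> row l \<and> card (L r1) = 2 \<and> card (L r2) = 2)"
    if l: "l \<in> S \<times> UNIV" for l
  proof (cases "\<exists>r\<in>row l. L r = {l}")
    case False
    then have other: "\<exists>m. m \<in> L r \<and> m \<noteq> l" if "r \<in> row l" for r
      using that by (auto simp: row_def)
    have "\<exists>v. vertex v \<and> (\<forall>l'\<in>{l}. sat v l')"
      by (rule satisfiable) (use l in \<open>auto simp: neg_def prod_eq_iff\<close>)
    then obtain r1 where r1: "r1 \<in> row l" using cover[OF _ l] by blast
    obtain m1 where m1: "m1 \<in> L r1" "m1 \<noteq> l" using other[OF r1] by blast
    have neg_in: "neg m \<in> S \<times> UNIV" if "m \<in> L r" for m r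
      using that L_sub[of r] by (auto simp: neg_def)
    have neg_ne: "neg x \<noteq> x" for x by (simp add: neg_def prod_eq_iff)
    have neg_eq: "neg x = neg y \<longleftrightarrow> x = y" "neg x = y \<longleftrightarrow> x = neg y" for x y
      by (metis neg_neg)+
    \<comment> \<open>At a vertex that satisfies \<open>l\<close> but not \<open>m1\<close> the term
      \<open>r1\<close> is dead, so another term \<open>r2\<close> must supply row \<open>l\<close>;
      by assumption there is no third.\<close>
    have "\<exists>v. vertex v \<and> (\<forall>l'\<in>{l, neg m1}. sat v l')"
    proof (rule satisfiable)
      show "card {l, neg m1} \<le> 3" by (simp add: card_insert_if)
      show "neg l' \<notin> {l, neg m1}" if "l' \<in> {l, neg m1}" for l'
        using that m1 neg_ne neg_eq by (metis insertE empty_iff)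
    qed (use l neg_in[OF m1(1)] in auto)
    then obtain v where v: "vertex v" "sat v l" "\<not> sat v m1" by auto
    obtain r2 where r2: "r2 \<in> row l" "0 < h r2 v" using cover[OF v(1) l v(2)] by blast
    have ne: "r1 \<noteq> r2" using sat_alive[OF v(1) _ r2(2), of m1] m1(1) r2(1) v(3) by (auto simp: row_def)
    have row_eq: "row l = {r1, r2}"
    proof (rule sym, rule card_seteq[OF fin_row])
      show "card (row l) \<le> card {r1, r2}" using row_le[OF l] ne by simp
    qed (use r1 r2 in auto)
    \<comment> \<open>Otherwise some vertex satisfies \<open>l\<close> and violates both
      \<open>x\<close> and \<open>y\<close>, and neither of the two terms of row \<open>l\<close> is
      alive there.\<close>
    have opp: "y = neg x" if "x \<in> L r1 - {l}" "y \<in> L r2 - {l}" for x y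
    proof (rule ccontr)
      assume nxy: "y \<noteq> neg x"
      have "\<exists>v. vertex v \<and> (\<forall>l'\<in>{l, neg x, neg y}. sat v l')"
      proof (rule satisfiable)
        show "card {l, neg x, neg y} \<le> 3" by (simp add: card_insert_if)
        show "neg l' \<notin> {l, neg x, neg y}" if "l' \<in> {l, neg x, neg y}" for l'
          using that \<open>x \<in> L r1 - {l}\<close> \<open>y \<in> L r2 - {l}\<close> neg_ne neg_eq nxy
          by (metis insertE empty_iff Diff_iff insertI1)
        show "{l, neg x, neg y} \<subseteq> S \<times> UNIV" using that l neg_in by blast
      qed auto
      then obtain w where w: "vertex w" "sat w l" "\<not> sat w x" "\<not> sat w y" by auto
      then obtain r where r: "r \<in> row l" "0 < h r w" using cover[OF w(1) l] by blast
      then have "r \<in> R" "r = r1 \<or> r = r2" using row_eq by (auto simp: row_def)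
      then show False
        using sat_alive[OF w(1) _ r(2)] w(3,4) that by blast
    qed
    obtain m2 where m2: "m2 \<in> L r2" "m2 \<noteq> l" using other[OF r2(1)] by blast
    \<comment> \<open>Every further element of \<open>L r1\<close> is the negation of
      \<open>m2\<close>, and every further element of \<open>L r2\<close> is the negation of
      \<open>m1\<close>; so each set has just one.\<close>
    have "x = m1" if "x \<in> L r1 - {l}" for x
      using opp[OF that, of m2] opp[of m1 m2] m1 m2 neg_eq by blast
    moreover have "y = m2" if "y \<in> L r2 - {l}" for y
      using opp[OF _ that, of m1] opp[of m1 m2] m1 m2 by blast
    moreover have "l \<in> L r1" "l \<in> L r2" using r1 r2(1) by (simp_all add: row_def)
    ultimately have "L r1 = {l, m1}" "L r2 = {l, m2}" using m1 m2 by blast+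
    then have "card (L r1) = 2" "card (L r2) = 2" using m1(2) m2(2) by auto
    then show ?thesis using ne r1 r2(1) by blast
  qed simp
  have fin: "finite (S \<times> (UNIV :: bool set))" using facD(1) by simp
  \<comment> \<open>Each term spreads at most weight one, evenly over the rows that it meets. Each
    row receives at least one, either from its own term or as two halves.\<close>
  have "real (2 * card S) = (\<Sum>l\<in>S \<times> (UNIV :: bool set). 1)"
    by (simp add: card_cartesian_product)
  also have "\<dots> \<le> (\<Sum>l\<in>S \<times> UNIV. \<Sum>r\<in>row l. 1 / real (card (L r)))"
  proof (rule sum_mono)
    fix l :: "nat \<times> bool" assume l: "l \<in> S \<times> UNIV"
    consider r where "r \<in> row l" "L r = {l}"
      | r1 r2 where "r1 \<noteq> r2" "r1 \<in> row l" "r2 \<in> row l" "card (L r1) = 2" "card (L r2) = 2"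
      using row_cases[OF l] by blast
    then show "1 \<le> (\<Sum>r\<in>row l. 1 / real (card (L r)))"
    proof cases
      case 1
      then show ?thesis
        using member_le_sum[of r "row l" "\<lambda>r. 1 / real (card (L r))"] fin_row by simp
    next
      case 2
      then have "(\<Sum>r\<in>{r1, r2}. 1 / real (card (L r))) \<le> (\<Sum>r\<in>row l. 1 / real (card (L r)))"
        by (intro sum_mono2 fin_row) auto
      then show ?thesis using 2 by simp
    qed
  qed
  also have "\<dots> = (\<Sum>l\<in>S \<times> UNIV. \<Sum>r\<in>R. if l \<in> L r then 1 / real (card (L r)) else 0)"
    unfolding row_def using facD(2) by (simp add: sum.inter_filter)
  also have "\<dots> = (\<Sum>r\<in>R. \<Sum>l\<in>S \<times> UNIV. if l \<in> L r then 1 / real (card (L r)) else 0)"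
    by (rule sum.swap)
  also have "\<dots> = (\<Sum>r\<in>R. \<Sum>l\<in>L r. 1 / real (card (L r)))"
  proof (rule sum.cong[OF refl])
    fix r
    have "(\<Sum>l\<in>S \<times> UNIV. if l \<in> L r then 1 / real (card (L r)) else 0) =
        (\<Sum>l | l \<in> S \<times> UNIV \<and> l \<in> L r. 1 / real (card (L r)))"
      by (rule sum.inter_filter[OF fin, symmetric])
    also have "{l. l \<in> S \<times> UNIV \<and> l \<in> L r} = L r" using L_sub by blast
    finally show "(\<Sum>l\<in>S \<times> UNIV. if l \<in> L r then 1 / real (card (L r)) else 0) =
        (\<Sum>l\<in>L r. 1 / real (card (L r)))" .
  qed
  also have "\<dots> \<le> (\<Sum>r\<in>R. 1)"
    by (rule sum_mono) simp
  finally show ?thesis by simp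
qed

end

subsection \<open>The lower bound for factorizations\<close>

text \<open>Call a term small if it meets no row \<open>x_i \<ge> 0\<close> (the set \<open>Z\<close>) and large if it meets two of
  them (the set \<open>R2\<close>); a large term lives on a single vertex. Counting incidences gives
  \<open>card R = 2 * card S + card Z - card C\<close>, where \<open>C\<close> contains the elements whose row has a single
  term and one element of each large term. A row \<open>x_d \<le> 1\<close> can be covered at an edge within \<open>C\<close> only by
  small terms, up to the few exceptions collected in \<open>P\<close>, so \<open>card Z\<close> cannot be much smaller than
  \<open>card C\<close>. The rank bound handles \<open>3 \<le> card C\<close>; smaller \<open>C\<close> force a contradiction among the remaining
  elements \<open>M\<close>, each of which has exactly two terms.\<close>

lemma (in reduced_factorization) card_ge_if_edges:
  assumes k2: "k = 2" and n4: "4 \<le> card S" and le2: "\<And>i. i \<in> S \<Longrightarrow> card (F i) \<le> 2"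
  shows "2 * card S \<le> card R + 2" "5 \<le> card S \<Longrightarrow> 2 * card S \<le> card R + 1"
    "6 \<le> card S \<Longrightarrow> 2 * card S \<le> card R"
proof -
  define Z where "Z = {r \<in> R. A r = {}}"
  define R2 where "R2 = {r \<in> R. card (A r) = 2}"
  define U where "U = {i \<in> S. card (F i) = 1}"
  define W where "W = \<Union> (A ` R2)"
  \<comment> \<open>\<open>P i\<close> will turn out to be the edge of the only large term at
    \<open>i\<close>, with \<open>i\<close> included, or empty if there is none.\<close>
  define P where "P i = \<Union> {A r | r. r \<in> R2 \<and> i \<in> A r}" for i
  define C where "C = U \<union> (\<lambda>r. Min (A r)) ` R2"
  define M where "M = S - (U \<union> W)"
  have fin: "finite Z" "finite R2" "finite U" "finite C" "finite W" "finite M"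
    using facD(1,2) finite_A by (auto simp: Z_def R2_def U_def C_def W_def M_def)
  have A_S: "A r \<subseteq> S" and B_S: "B r \<subseteq> S" for r by (auto simp: A_def B_def)
  have edge: "vertex {i, j}" if "i \<in> S" "j \<in> S" "i \<noteq> j" for i j
    unfolding vertex_def using that k2 by simp
  have vertex_card: "card v = 2" if "vertex v" for v using that k2 unfolding vertex_def by simp
  have card_A: "card (A r) \<le> 2" if r: "r \<in> R" for r
  proof -
    obtain v where v: "vertex v" "0 < h r v" using alive_vertex[OF r] by blast
    then show ?thesis using card_mono[OF vertexD(2) A_subset[OF _ r]] vertex_card by metis
  qed
  have self: "i \<notin> B r" if r: "r \<in> R" "i \<in> A r" for r i
  proof -
    obtain v where v: "vertex v" "0 < h r v" using alive_vertex[OF r(1)] by blast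
    then show ?thesis using A_subset[OF v(1) r(1) v(2)] B_disjoint[OF v(1) r(1) v(2)] r by blast
  qed
  have cover_F: "\<exists>r\<in>F i. 0 < h r {i, j}" if "i \<in> S" "j \<in> S" "i \<noteq> j" for i j
    using cover_A[OF edge[OF that], of i] by (auto simp: F_def)
  have alive_B: "i \<notin> B r" "j \<notin> B r" if "r \<in> R" "0 < h r {i, j}" "i \<in> S" "j \<in> S" "i \<noteq> j" for r i j
    using B_disjoint[OF edge[OF that(3-5)] that(1,2)] by auto
  have alive_A: "A r \<subseteq> {i, j}" if "r \<in> R" "0 < h r {i, j}" "i \<in> S" "j \<in> S" "i \<noteq> j" for r i j
    using A_subset[OF edge[OF that(3-5)] that(1,2)] .

  have R2_alive: "v = A r" if "r \<in> R2" "vertex v" "0 < h r v" for r v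
    using that vertex_card A_subset[of v r] vertexD(2) card_seteq[of v "A r"] by (auto simp: R2_def)
  \<comment> \<open>A large term serves only its own edge, so the other edges at \<open>i\<close>
    need a second term \<open>r'\<close>, unique by \<open>le2\<close>. Being alive on all of them,
    it meets no row \<open>x_d <= 1\<close> with \<open>d\<close> outside \<open>A r\<close>; two
    such edges, available since \<open>4 <= card S\<close>, force \<open>A r' = {i}\<close>.\<close>
  have F_R2: "\<exists>r'. F i = {r, r'} \<and> r' \<noteq> r \<and> A r' = {i} \<and> B r' \<subseteq> A r" if r: "r \<in> R2" "i \<in> A r" for r i
  proof -
    have "card (A r) = 2" using r by (simp add: R2_def)
    then obtain p q where "A r = {p, q}" "p \<noteq> q" by (auto simp: card_2_iff)
    then have "A r = {i, p} \<and> i \<noteq> p \<or> A r = {i, q} \<and> i \<noteq> q" using r(2) by auto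
    then obtain j where j: "A r = {i, j}" "i \<noteq> j" by blast
    have ij: "i \<in> S" "j \<in> S" using A_S[of r] j by auto
    have "2 \<le> card (S - {i, j})" using n4 ij j by (simp add: card_Diff_subset)
    then obtain t where "t \<subseteq> S - {i, j}" "card t = 2" by (rule obtain_subset_with_card_n)
    then obtain j1 j2 where j12: "j1 \<noteq> j2" "{j1, j2} \<subseteq> S - {i, j}" by (auto simp: card_2_iff)
    have edges: "{i, d} \<noteq> A r" if "d \<notin> {i, j}" for d using that j by (auto simp: doubleton_eq_iff)
    obtain r1 where r1: "r1 \<in> F i" "0 < h r1 {i, j1}" using cover_F[of i j1] ij j12 by auto
    obtain r2 where r2: "r2 \<in> F i" "0 < h r2 {i, j2}" using cover_F[of i j2] ij j12 by auto
    have vt: "vertex {i, j1}" "vertex {i, j2}" using edge ij j12 by auto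
    have ne: "r1 \<noteq> r" "r2 \<noteq> r"
      using R2_alive[OF r(1) vt(1)] R2_alive[OF r(1) vt(2)] r1 r2 edges[of j1] edges[of j2] j12 by auto
    have rF: "r \<in> F i" using r by (auto simp: F_def R2_def)
    have "r1 = r2"
    proof (rule ccontr)
      assume "r1 \<noteq> r2"
      then have "card {r, r1, r2} = 3" using ne by simp
      moreover have "card {r, r1, r2} \<le> card (F i)"
        using rF r1 r2 by (intro card_mono finite_F) auto
      ultimately show False using le2[OF ij(1)] by linarith
    qed
    have Fi: "F i = {r, r1}"
    proof (rule sym, rule card_seteq[OF finite_F])
      show "card (F i) \<le> card {r, r1}" using le2[OF ij(1)] ne by simp
    qed (use rF r1 in auto)
    have r1R: "r1 \<in> R" "i \<in> A r1" using r1 by (auto simp: F_def)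
    have "A r1 \<subseteq> {i, j1} \<inter> {i, j2}"
      using alive_A[of r1] r1R r1 r2 \<open>r1 = r2\<close> ij j12 by (metis Int_subset_iff insert_subset DiffD1 DiffD2 insertI1)
    then have "A r1 = {i}" using r1R j12 by auto
    moreover have "B r1 \<subseteq> A r"
    proof
      fix d assume d: "d \<in> B r1"
      show "d \<in> A r"
      proof (rule ccontr)
        assume "d \<notin> A r"
        then have dd: "d \<notin> {i, j}" "d \<in> S" using j d B_S by auto
        then obtain r3 where r3: "r3 \<in> F i" "0 < h r3 {i, d}" using cover_F[of i d] ij by auto
        have "r3 \<noteq> r" using R2_alive[OF r(1) edge[of i d]] r3 dd ij edges[of d] by auto
        then have "0 < h r1 {i, d}" using r3 Fi by auto
        then show False using alive_B[of r1 i d] r1R ij dd d by auto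
      qed
    qed
    ultimately show ?thesis using Fi ne by auto
  qed
  have F_W: "card (F i) = 2" if "r \<in> R2" "i \<in> A r" for r i
    using F_R2[OF that] by auto
  have R2_unique: "r = s" if rs: "r \<in> R2" "s \<in> R2" "i \<in> A r" "i \<in> A s" for r s i
  proof -
    obtain r' where r': "F i = {r, r'}" "A r' = {i}" using F_R2[OF rs(1,3)] by auto
    have "s \<in> F i" "s \<noteq> r'" using that r' by (auto simp: F_def R2_def)
    then show ?thesis using r' by auto
  qed
  have P_eq: "P i = A r" if r: "r \<in> R2" "i \<in> A r" for r i
  proof -
    have "{A r' | r'. r' \<in> R2 \<and> i \<in> A r'} = {A r}" using R2_unique[OF r(1) _ r(2)] r by blast
    then show ?thesis by (simp add: P_def)
  qed
  have C_sub: "C \<subseteq> U \<union> W" "U \<union> W \<subseteq> S"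
  proof -
    have "Min (A r) \<in> A r" if "r \<in> R2" for r
      using that finite_A[of r] by (intro Min_in) (auto simp: R2_def)
    then show "C \<subseteq> U \<union> W" by (auto simp: C_def W_def)
    show "U \<union> W \<subseteq> S" using A_S by (auto simp: U_def W_def)
  qed
  have C_Min: "i = Min (A r)" if ir: "i \<in> C" "r \<in> R2" "i \<in> A r" for i r
  proof -
    have "i \<notin> U" using F_W[OF that(2,3)] by (simp add: U_def)
    then obtain s where s: "s \<in> R2" "i = Min (A s)" using ir(1) by (auto simp: C_def)
    then have "i \<in> A s" using finite_A[of s] by (auto simp: R2_def intro!: Min_in)
    then show ?thesis using R2_unique[OF that(2) s(1) that(3)] s by simp
  qed
  have not_partner: "j \<notin> P i" if "i \<in> C" "j \<in> C" "i \<noteq> j" for i j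
  proof
    assume "j \<in> P i"
    then obtain r where "r \<in> R2" "i \<in> A r" "j \<in> A r" by (auto simp: P_def)
    then show False using C_Min[of i r] C_Min[of j r] that by simp
  qed
  \<comment> \<open>In both cases \<open>r\<close> is the only term available for the edges
    \<open>{i, d}\<close> with \<open>d\<close> outside \<open>P i\<close>, so it is alive there and
    cannot meet the row \<open>x_d <= 1\<close>.\<close>
  have closed: "B r \<subseteq> P i" if i: "i \<in> U \<union> W" and r: "r \<in> R" "A r = {i}" for i r
  proof (cases "i \<in> W")
    case True
    then obtain s where s: "s \<in> R2" "i \<in> A s" by (auto simp: W_def)
    then obtain r' where r': "F i = {s, r'}" "B r' \<subseteq> A s" using F_R2 by blast
    have "r \<in> F i" "r \<noteq> s" using s r by (auto simp: F_def R2_def)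
    then show ?thesis using r' P_eq[OF s] by auto
  next
    case False
    then have "card (F i) = 1" "i \<in> S" using i by (auto simp: U_def)
    moreover have rF: "r \<in> F i" using r by (auto simp: F_def)
    ultimately have Fi: "F i = {r}" by (auto simp: card_1_singleton_iff)
    have False if d: "d \<in> B r" for d
    proof -
      have "d \<noteq> i" "d \<in> S" using d self[of r i] r B_S by auto
      then have "0 < h r {i, d}" using cover_F[of i d] \<open>i \<in> S\<close> Fi by auto
      then show False using alive_B[of r i d] d r \<open>i \<in> S\<close> \<open>d \<in> S\<close> \<open>d \<noteq> i\<close> by auto
    qed
    then show ?thesis by blast
  qed

  have card_C: "card C = card U + card R2"
  proof -
    have "inj_on (\<lambda>r. Min (A r)) R2"
    proof (rule inj_onI)
      fix r s assume rs: "r \<in> R2" "s \<in> R2" "Min (A r) = Min (A s)"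
      have "Min (A r) \<in> A r" "Min (A s) \<in> A s"
        using rs(1,2) finite_A by (auto simp: R2_def intro!: Min_in)
      then show "r = s" using R2_unique rs by metis
    qed
    moreover have "U \<inter> (\<lambda>r. Min (A r)) ` R2 = {}"
    proof -
      have "Min (A r) \<notin> U" if "r \<in> R2" for r
      proof -
        have "Min (A r) \<in> A r" using that finite_A[of r] by (auto simp: R2_def intro!: Min_in)
        then show ?thesis using F_W[OF that] by (simp add: U_def)
      qed
      then show ?thesis by blast
    qed
    ultimately show ?thesis
      unfolding C_def using fin by (simp add: card_Un_disjoint card_image)
  qed
  have card_F: "card (F i) = 1 \<or> card (F i) = 2" if "i \<in> S" for i
  proof -
    have "card (S - {i}) \<ge> 1" using n4 that by simp
    then have "S - {i} \<noteq> {}" by force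
    then obtain j where "j \<in> S" "j \<noteq> i" by auto
    then have "F i \<noteq> {}" using cover_F[OF that, of j] by auto
    then have "0 < card (F i)" using finite_F by (simp add: card_gt_0_iff)
    then show ?thesis using le2[OF that] by linarith
  qed
  \<comment> \<open>Incidences of terms with rows \<open>x_i >= 0\<close>. By rows: two for each
    \<open>i\<close>, less one on \<open>U\<close>. By terms: one for each, less one on
    \<open>Z\<close>, plus one on \<open>R2\<close>.\<close>
  have count: "2 * card S + card Z = card R + card C"
  proof -
    have "(\<Sum>i\<in>S. card (F i) + (if card (F i) = 1 then 1 else 0)) = (\<Sum>i\<in>S. 2)"
      using card_F by (intro sum.cong refl) auto
    moreover have "(\<Sum>i\<in>S. if card (F i) = 1 then 1 else 0) = card U"
      unfolding U_def using facD(1) by (simp add: sum.If_cases Int_def)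
    ultimately have 1: "(\<Sum>i\<in>S. card (F i)) + card U = 2 * card S"
      by (simp add: sum.distrib)
    have 2: "(\<Sum>i\<in>S. card (F i)) = (\<Sum>r\<in>R. card (A r))"
      unfolding F_def
    proof (rule sum_multicount_gen[OF facD(1,2)], rule ballI)
      fix r assume "r \<in> R"
      have "{i \<in> S. i \<in> A r} = A r" using A_S by blast
      then show "card {i \<in> S. i \<in> A r} = card (A r)" by simp
    qed
    have "(\<Sum>r\<in>R. 1 + (if card (A r) = 2 then 1 else 0)) = (\<Sum>r\<in>R. (if A r = {} then 1 else 0) + card (A r))"
    proof (rule sum.cong[OF refl])
      fix r assume "r \<in> R"
      then consider "card (A r) = 0" | "card (A r) = 1" | "card (A r) = 2" using card_A[of r] by linarith
      then show "1 + (if card (A r) = 2 then 1 else 0) = (if A r = {} then 1 else 0) + card (A r)"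
        using finite_A[of r] by cases auto
    qed
    moreover have "(\<Sum>r\<in>R. if card (A r) = 2 then 1 else 0) = card R2"
      unfolding R2_def using facD(2) by (simp add: sum.If_cases Int_def)
    moreover have "(\<Sum>r\<in>R. if A r = {} then 1 else 0) = card Z"
      unfolding Z_def using facD(2) by (simp add: sum.If_cases Int_def)
    ultimately have "card R + card R2 = card Z + (\<Sum>r\<in>R. card (A r))"
      unfolding sum.distrib by simp
    then show ?thesis using 1 2 card_C by linarith
  qed

  have CS: "i \<in> S" if "i \<in> C" for i using that C_sub by blast
  \<comment> \<open>A singleton term reaches only partners, by \<open>closed\<close>. A large term
    on \<open>{i, j}\<close> would make \<open>j\<close> a partner of \<open>i\<close>, but
    \<open>C\<close> has only one end of each large edge.\<close>
  have nonZ: "A r = {} \<or> d \<in> P i \<union> P j"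
    if ij: "i \<in> C" "j \<in> C" "i \<noteq> j" and r: "r \<in> R" "0 < h r {i, j}" "d \<in> B r" for i j d r
  proof -
    have "A r \<subseteq> {i, j}" using alive_A[OF r(1,2) CS[OF ij(1)] CS[OF ij(2)] ij(3)] .
    then consider "A r = {}" | "A r = {i}" | "A r = {j}" | "A r = {i, j}" by blast
    then show ?thesis
    proof cases
      case 4
      then have "r \<in> R2" using r ij by (simp add: R2_def)
      then have "j \<in> P i" using P_eq[of r i] 4 by simp
      then show ?thesis using not_partner[OF ij] by blast
    next
      case 2 then show ?thesis using closed[of i r] ij C_sub r by auto
    next
      case 3 then show ?thesis using closed[of j r] ij C_sub r by auto
    qed simp
  qed
  have cover_Z: "\<exists>r\<in>Z. d \<in> B r \<and> 0 < h r {i, j}"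
    if ij: "i \<in> C" "j \<in> C" "i \<noteq> j" and d: "d \<in> S" "d \<notin> {i, j}" "d \<notin> P i" "d \<notin> P j" for i j d
    using cover_B[OF edge[OF CS[OF ij(1)] CS[OF ij(2)] ij(3)] d(1,2)] nonZ[OF ij] d(3,4)
    by (metis (mono_tags, lifting) UnE Z_def mem_Collect_eq)

  \<comment> \<open>For \<open>d\<close> and \<open>v\<close> inside \<open>C\<close> the exceptions
    disappear, so the terms in \<open>Z\<close> alone factor the matrix
    \<open>[d \<notin> v]\<close>. Three elements are needed because the rank bound requires
    \<open>k < card C\<close>.\<close>
  have C3: "card C \<le> card Z" if c3: "3 \<le> card C"
  proof (rule card_le_of_factorization[OF fin(4,1), where k = 2 and b = b and h = h])
    fix v d assume v: "v \<subseteq> C" "card v = 2" and d: "d \<in> C"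
    then obtain i j where ij: "v = {i, j}" "i \<noteq> j" "i \<in> C" "j \<in> C" by (auto simp: card_2_iff)
    have vS: "v \<subseteq> S" "card v = k" using v CS k2 by auto
    have "(\<Sum>r\<in>Z. b r d * h r v) = (\<Sum>r\<in>R. b r d * h r v)"
    proof (rule sum.mono_neutral_left[OF facD(2)], use Z_def in blast, rule ballI, rule ccontr)
      fix r assume r: "r \<in> R - Z" and ne: "b r d * h r v \<noteq> 0"
      have "0 \<le> b r d" "0 \<le> h r v" using facD(4)[of r d] facD(5)[of v r] r CS[OF d] vS
        by (auto simp: vertex_def)
      then have pos: "0 < b r d" "0 < h r v" using ne by auto
      then have dB: "d \<in> B r" using CS[OF d] by (simp add: B_def)
      have "A r \<noteq> {}" "r \<in> R" using r by (auto simp: Z_def)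
      then have "d \<in> P i \<union> P j" using nonZ[of i j r d] ij pos dB by blast
      moreover have "d \<notin> v" using B_disjoint[of v r] dB pos vS \<open>r \<in> R\<close> by (auto simp: vertex_def)
      ultimately show False using not_partner[of i d] not_partner[of j d] ij d by auto
    qed
    then show "(\<Sum>r\<in>Z. b r d * h r v) = of_bool (d \<notin> v)"
      using facD(7)[of v d] vS CS[OF d] by (simp add: vertex_def)
  qed (use c3 in auto)
  \<comment> \<open>Two elements and their partners occupy at most four places, so the row of a
    fifth element needs a term in \<open>Z\<close>.\<close>
  have C2: "1 \<le> card Z" if c2: "card C = 2" and n5: "5 \<le> card S"
  proof -
    obtain x y where xy: "C = {x, y}" "x \<noteq> y" using c2 by (auto simp: card_2_iff)
    have P2: "finite (P i) \<and> card (insert i (P i)) \<le> 2" for i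
    proof (cases "\<exists>r. r \<in> R2 \<and> i \<in> A r")
      case True
      then obtain r where r: "r \<in> R2" "i \<in> A r" by blast
      then show ?thesis using P_eq[OF r] finite_A[of r] by (simp add: insert_absorb R2_def)
    next
      case False
      then have "P i = {}" by (auto simp: P_def)
      then show ?thesis by simp
    qed
    have "card (insert x (P x) \<union> insert y (P y)) \<le> 4"
      using card_Un_le[of "insert x (P x)" "insert y (P y)"] P2[of x] P2[of y] by linarith
    then have "\<not> S \<subseteq> insert x (P x) \<union> insert y (P y)"
      using card_mono[of "insert x (P x) \<union> insert y (P y)" S] n5 P2 by auto
    then obtain d where "d \<in> S" "d \<notin> {x, y}" "d \<notin> P x" "d \<notin> P y" by auto
    then have "Z \<noteq> {}" using cover_Z[of x y d] xy by auto
    then show ?thesis using fin by (simp add: Suc_le_eq card_gt_0_iff)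
  qed
  \<comment> \<open>By \<open>count\<close> the deficit is \<open>card C - card Z\<close>: not
    positive if \<open>card C\<close> is at least three, otherwise at most two, and at most one once
    \<open>C2\<close> applies.\<close>
  show "2 * card S \<le> card R + 2" using count C3 by linarith
  show n5: "2 * card S \<le> card R + 1" if "5 \<le> card S"
    using count C3 C2 that by linarith

  show "2 * card S \<le> card R" if n6: "6 \<le> card S"
  proof (rule ccontr)
    assume less: "\<not> 2 * card S \<le> card R"
    have card_M: "card S \<le> card M + 2 * card C"
    proof -
      have "card W \<le> (\<Sum>r\<in>R2. card (A r))" unfolding W_def by (rule card_UN_le[OF fin(2)])
      also have "\<dots> = 2 * card R2" by (simp add: R2_def)
      finally have "card (U \<union> W) \<le> 2 * card C"
        using card_C card_Un_le[of U W] by linarith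
      moreover have "card M = card S - card (U \<union> W)" unfolding M_def
        using C_sub fin by (intro card_Diff_subset) auto
      ultimately show ?thesis by linarith
    qed
    have MS: "a \<in> S" "a \<notin> W" "a \<notin> U" if "a \<in> M" for a using that by (auto simp: M_def)
    have MP: "a \<notin> P i" if "a \<in> M" for a i using MS(2)[OF that] by (auto simp: P_def W_def)
    have F2: "t = r \<or> t = s" if "a \<in> M" "r \<in> F a" "s \<in> F a" "r \<noteq> s" "t \<in> F a" for a r s t
    proof -
      have "F a = {r, s}"
        using that le2[of a] MS by (intro sym[OF card_seteq[OF finite_F]]) auto
      then show ?thesis using that by auto
    qed
    have FR: "r \<in> R" if "r \<in> F a" for r a using that by (simp add: F_def)
    \<comment> \<open>At the edge \<open>{a, d}\<close> one of the two terms of \<open>a\<close> is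
      alive, and that term cannot meet the row \<open>x_d <= 1\<close>.\<close>
    have MB: "d \<notin> B s" if a: "a \<in> M" and rs: "r \<in> F a" "s \<in> F a" "r \<noteq> s" and d: "d \<in> B r" for a r s d
    proof
      assume ds: "d \<in> B s"
      have "d \<noteq> a" using self[of r a] rs d by (auto simp: F_def)
      moreover have "d \<in> S" using d B_S by blast
      ultimately obtain t where t: "t \<in> F a" "0 < h t {a, d}" using cover_F[of a d] MS[OF a] by auto
      then have "t = r \<or> t = s" using F2[OF a rs] by blast
      then show False
        using alive_B[OF FR[OF t(1)] t(2) MS(1)[OF a] \<open>d \<in> S\<close>] \<open>d \<noteq> a\<close> d ds by auto
    qed
    \<comment> \<open>Among the terms alive at \<open>{x, a}\<close>, singletons at \<open>x\<close>
      reach only \<open>P x\<close>, and no large term contains \<open>a\<close>. So, apart from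
      \<open>Z\<close>, only terms of \<open>a\<close> can supply the row
      \<open>x_d <= 1\<close>.\<close>
    have via: "\<exists>r\<in>F a. d \<in> B r \<and> x \<notin> B r"
      if x: "x \<in> C" and a: "a \<in> M" and d: "d \<in> S" "d \<noteq> x" "d \<noteq> a" "d \<notin> P x"
        and noZ: "\<And>r. r \<in> Z \<Longrightarrow> d \<in> B r \<Longrightarrow> \<not> 0 < h r {x, a}" for x a d
    proof -
      have xa: "x \<in> S" "a \<in> S" "x \<noteq> a" using CS[OF x] MS[OF a] x C_sub by auto
      obtain r where r: "r \<in> R" "0 < h r {x, a}" "d \<in> B r"
        using cover_B[OF edge[OF xa] d(1)] d by auto
      have "A r \<noteq> {}" using noZ[of r] r by (auto simp: Z_def)
      moreover have "A r \<noteq> {x}" using closed[of x r] x C_sub r d by auto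
      moreover have "A r \<noteq> {x, a}"
      proof
        assume "A r = {x, a}"
        then have "r \<in> R2" using r xa by (simp add: R2_def)
        then show False using MS(2)[OF a] \<open>A r = {x, a}\<close> by (auto simp: W_def)
      qed
      ultimately have "A r = {a}" using alive_A[OF r(1,2) xa] by blast
      then have "r \<in> F a" using r by (simp add: F_def)
      then show ?thesis using alive_B[OF r(1,2) xa] r(3) by blast
    qed
    have cases: "(card C = 1 \<and> card Z = 0) \<or> (card C = 2 \<and> card Z = 1)"
      using count C3 C2 n6 less by linarith
    then show False
    proof
      assume "card C = 2 \<and> card Z = 1"
      then obtain x y z where xy: "C = {x, y}" "x \<noteq> y" and z: "Z = {z}" and c: "card C = 2"
        by (auto simp: card_2_iff card_1_singleton_iff)
      have "2 \<le> card M" using card_M n6 c by linarith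
      then obtain t where "t \<subseteq> M" "card t = 2" by (rule obtain_subset_with_card_n)
      then obtain a a' where a: "a \<in> M" "a' \<in> M" "a \<noteq> a'" by (auto simp: card_2_iff)
      have MC: "w \<noteq> x" "w \<noteq> y" if "w \<in> M" for w using MS[OF that] xy C_sub by auto
      \<comment> \<open>The only small term \<open>z\<close> meets the row \<open>x_a <= 1\<close>,
        so it is dead on the edges at \<open>a\<close>. Then \<open>y\<close> and \<open>x\<close>
        are supplied by two different terms \<open>r\<close> and \<open>s\<close> of
        \<open>a\<close>, and \<open>a'\<close> would have to be supplied by both, against
        \<open>MB\<close>.\<close>
      have "a \<in> B z" using cover_Z[of x y a] xy z MC a MS MP by auto
      have zR: "z \<in> R" using z by (auto simp: Z_def)
      have xyS: "x \<in> S" "y \<in> S" using CS xy by auto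
      have noZ: "\<not> 0 < h r {w, a}" if "r \<in> Z" "w \<in> C" for r w
        using alive_B(2)[OF zR, of w a] \<open>a \<in> B z\<close> that z MS[OF a(1)] CS MC[OF a(1)] xy by auto
      obtain r where r: "r \<in> F a" "y \<in> B r" "x \<notin> B r"
        using via[of x a y] noZ xy a(1) MC[OF a(1)] xyS not_partner[of x y] by auto
      obtain s where s: "s \<in> F a" "x \<in> B s" "y \<notin> B s"
        using via[of y a x] noZ xy a(1) MC[OF a(1)] xyS not_partner[of y x] by auto
      obtain r' where r': "r' \<in> F a" "a' \<in> B r'" "x \<notin> B r'"
        using via[of x a a'] noZ xy a MC[OF a(2)] MS[OF a(2)] MP[OF a(2)] by auto
      obtain s' where s': "s' \<in> F a" "a' \<in> B s'" "y \<notin> B s'"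
        using via[of y a a'] noZ xy a MC[OF a(2)] MS[OF a(2)] MP[OF a(2)] by auto
      have "r' = r" "s' = s" using F2[OF a(1) r(1) s(1)] r s r' s' by auto
      then show False using MB[OF a(1) r(1) s(1)] r s r' s' by auto
    next
      assume c: "card C = 1 \<and> card Z = 0"
      then obtain x where x: "C = {x}" and Z: "Z = {}" using fin by (auto simp: card_1_singleton_iff)
      have xC: "x \<in> C" "x \<in> S" using x CS by auto
      have xM: "x \<notin> M" using xC C_sub by (auto simp: M_def)
      have "3 \<le> card M" using card_M n6 c by linarith
      then obtain t where "t \<subseteq> M" "card t = 3" by (rule obtain_subset_with_card_n)
      then obtain a1 a2 a3 where a: "a1 \<in> M" "a2 \<in> M" "a3 \<in> M" "a1 \<noteq> a2" "a1 \<noteq> a3" "a2 \<noteq> a3"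
        by (auto simp: card_3_iff)
      \<comment> \<open>There are no small terms now. The edges \<open>{p, q}\<close> within
        \<open>M\<close> show that at most one element of \<open>M\<close> fails \<open>X\<close>;
        yet two elements with \<open>X\<close> exclude each other as soon as \<open>M\<close> has a
        third element.\<close>
      define X where "X w \<longleftrightarrow> (\<exists>r\<in>F w. x \<in> B r)" for w
      have cover_M: "\<exists>r. (r \<in> F p \<or> r \<in> F q) \<and> d \<in> B r \<and> p \<notin> B r \<and> q \<notin> B r"
        if pq: "p \<in> M" "q \<in> M" "p \<noteq> q" and d: "d \<in> S" "d \<noteq> p" "d \<noteq> q" for p q d
      proof -
        have pqS: "p \<in> S" "q \<in> S" using MS pq by auto
        obtain r where r: "r \<in> R" "0 < h r {p, q}" "d \<in> B r"
          using cover_B[OF edge[OF pqS pq(3)] d(1)] d by auto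
        have "A r \<noteq> {}" using Z r by (auto simp: Z_def)
        then have "p \<in> A r \<or> q \<in> A r" using alive_A[OF r(1,2) pqS pq(3)] by blast
        then show ?thesis using r alive_B[OF r(1,2) pqS pq(3)] by (auto simp: F_def)
      qed
      have pair: "X p \<or> X q" if "p \<in> M" "q \<in> M" "p \<noteq> q" for p q
        using cover_M[OF that xC(2)] that xM by (auto simp: X_def)
      \<comment> \<open>One of the two terms of \<open>p\<close> meets the row
        \<open>x_x <= 1\<close> and is dead at the edge \<open>{x, p}\<close>, so the other one
        alone supplies all other elements of \<open>M\<close> there.\<close>
      have XB: "q \<in> B t" if X: "X p" and p: "p \<in> M" and t: "t \<in> F p" "d \<in> B t"
        and d: "d \<in> M" "d \<noteq> p" and q: "q \<in> M" "q \<noteq> p" for p q d t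
      proof -
        obtain r where r: "r \<in> F p" "x \<in> B r" using X by (auto simp: X_def)
        obtain s where s: "s \<in> F p" "d \<in> B s" "x \<notin> B s"
          using via[of x p d] xC p d MS[OF d(1)] MP[OF d(1)] xM Z by auto
        obtain s' where s': "s' \<in> F p" "q \<in> B s'" "x \<notin> B s'"
          using via[of x p q] xC p q MS[OF q(1)] MP[OF q(1)] xM Z by auto
        have "r \<noteq> s" "r \<noteq> s'" using r s s' by auto
        then have "t \<noteq> r" using MB[OF p s(1) r(1)] s t by auto
        then have "t = s'" using F2[OF p r(1) s'(1) \<open>r \<noteq> s'\<close> t(1)] by simp
        then show ?thesis using s' by simp
      qed
      \<comment> \<open>The term that supplies \<open>d\<close> at the edge \<open>{p, q}\<close>
        belongs to \<open>p\<close> or to \<open>q\<close>. By \<open>XB\<close> the other endpoint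
        is then in its \<open>B\<close> set, which is impossible for a term alive at that
        edge.\<close>
      have noXX: False if pqd: "X p" "X q" "p \<in> M" "q \<in> M" "d \<in> M" "p \<noteq> q" "d \<noteq> p" "d \<noteq> q" for p q d
      proof -
        obtain r where r: "r \<in> F p \<or> r \<in> F q" "d \<in> B r" "p \<notin> B r" "q \<notin> B r"
          using cover_M[of p q d] pqd MS by auto
        then show False using XB[of p r d q] XB[of q r d p] pqd by auto
      qed
      show False
        using pair[of a1 a2] pair[of a1 a3] pair[of a2 a3] noXX[of a1 a2 a3] noXX[of a1 a3 a2]
          noXX[of a2 a3 a1] a by auto
    qed
  qed
qed

section \<open>Induction on the ground set\<close>

lemma slack_factorization_reduce:
  assumes "slack_factorization S k R a b h"
  obtains R' where "R' \<subseteq> R" "reduced_factorization S k R' a b h"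
proof
  show "reduced_factorization S k {r \<in> R. \<exists>v\<subseteq>S. card v = k \<and> 0 < h r v} a b h"
    using slack_factorization_prune[OF assms] by unfold_locales auto
qed auto

text \<open>The two lines meet at \<open>n = 6\<close>; up to there the bound grows by three, the
  least number of terms in a heavy row. The value at \<open>n = 3\<close> only anchors the induction
  for \<open>k = 2\<close>.\<close>

definition hypersimplex_bound :: "nat \<Rightarrow> nat"
  where "hypersimplex_bound n = (if n \<le> 5 then 3 * (n - 2) else 2 * n)"

lemma hypersimplex_bound_Suc: "3 \<le> n \<Longrightarrow> hypersimplex_bound (Suc n) \<le> hypersimplex_bound n + 3"
  by (auto simp: hypersimplex_bound_def)

lemma slack_factorization_edges_bound:
  assumes "slack_factorization S 2 R a b h" "3 \<le> card S"
  shows "hypersimplex_bound (card S) \<le> card R"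
  using assms
proof (induction "card S" arbitrary: S R)
  case (Suc n)
  note fac = Suc.prems(1)
  show ?case
  proof (cases "card S = 3")
    case True
    have "card S \<le> card R"
      using slack_factorizationD(1,2,7)[OF fac] True
      by (intro card_le_of_factorization[where k = 2 and b = b and h = h]) auto
    then show ?thesis using True by (simp add: hypersimplex_bound_def)
  next
    case False
    then have n: "4 \<le> card S" using Suc by linarith
    obtain R' where R': "R' \<subseteq> R" "reduced_factorization S 2 R' a b h"
      using slack_factorization_reduce[OF fac] .
    interpret reduced_factorization S 2 R' a b h by (rule R')
    have "hypersimplex_bound (card S) \<le> card R'"
    proof (cases "\<exists>i\<in>S. 3 \<le> card (F i)")
      case True
      then obtain i where i: "i \<in> S" "3 \<le> card (F i)" by blast
      have "hypersimplex_bound (card (S - {i})) + card (F i) \<le> card R'"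
      proof (rule F_facet_bound[OF i(1)])
        fix R'' assume "slack_factorization (S - {i}) 2 R'' a b h"
        moreover have "n = card (S - {i})" "3 \<le> card (S - {i})" using Suc(2) i n by simp_all
        ultimately show "hypersimplex_bound (card (S - {i})) \<le> card R''" using Suc(1) by blast
      qed
      moreover have "hypersimplex_bound (card S) \<le> hypersimplex_bound (card (S - {i})) + 3"
        using hypersimplex_bound_Suc[of "card (S - {i})"] card_Suc_Diff1[OF facD(1) i(1)] n by simp
      ultimately show ?thesis using i by linarith
    next
      case False
      then have le2: "\<And>i. i \<in> S \<Longrightarrow> card (F i) \<le> 2" by force
      have "card S = 4 \<or> card S = 5 \<or> 6 \<le> card S" using n by linarith
      then show ?thesis
        using card_ge_if_edges[OF refl n le2] by (auto simp: hypersimplex_bound_def)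
    qed
    then show ?thesis
      using card_mono[OF slack_factorizationD(2)[OF Suc.prems(1)] R'(1)] by linarith
  qed
qed simp

theorem slack_factorization_bound:
  assumes "slack_factorization S k R a b h" "2 \<le> k" "k + 2 \<le> card S"
  shows "hypersimplex_bound (card S) \<le> card R"
  using assms
\<comment> \<open>\<open>k\<close>, \<open>a\<close>, \<open>b\<close> and \<open>h\<close> are
  generalized because the step for the rows \<open>x_i <= 1\<close> passes to the complementary
  factorization.\<close>
proof (induction "card S" arbitrary: S k R a b h)
  case (Suc n)
  note fac = Suc.prems(1)
  consider "k = 2" | "card S - k = 2" | "3 \<le> k" "k + 3 \<le> card S" using Suc.prems by linarith
  then show ?case
  proof cases
    case 1
    then show ?thesis using slack_factorization_edges_bound Suc.prems by fastforce
  next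
    case 2
    moreover have "k \<le> card S" using Suc.prems by linarith
    ultimately show ?thesis
      using slack_factorization_edges_bound slack_factorization_complement[OF fac] Suc.prems by fastforce
  next
    case 3
    obtain R' where R': "R' \<subseteq> R" "reduced_factorization S k R' a b h"
      using slack_factorization_reduce[OF fac] .
    interpret reduced_factorization S k R' a b h by (rule R')
    interpret c: reduced_factorization S "card S - k" R' b a "\<lambda>r v. h r (S - v)"
      using 3 by (intro reduced_complement) simp
    have GF: "c.F i = G i" for i
      by (simp add: c.F_def G_def c.A_def B_def)
    have step: "hypersimplex_bound (card S) \<le> hypersimplex_bound (card (S - {i})) + 3" if "i \<in> S" for i
      using hypersimplex_bound_Suc[of "card (S - {i})"] card_Suc_Diff1[OF facD(1) that] 3 by simp
    have n: "n = card (S - {i})" if "i \<in> S" for i using Suc(2) that by simp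
    have "hypersimplex_bound (card S) \<le> card R'"
    proof (cases "\<exists>i\<in>S. 3 \<le> card (F i) \<or> 3 \<le> card (G i)")
      case True
      \<comment> \<open>Since \<open>3 <= k\<close> and \<open>k + 3 <= card S\<close>, both
        \<open>k\<close> and \<open>card S - k\<close> remain admissible for the ground set without
        \<open>i\<close>.\<close>
      then obtain i where i: "i \<in> S" "3 \<le> card (F i) \<or> 3 \<le> card (c.F i)" using GF by auto
      have "hypersimplex_bound (card (S - {i})) + card (F i) \<le> card R'"
      proof (rule F_facet_bound[OF i(1)])
        fix R'' assume "slack_factorization (S - {i}) k R'' a b h"
        then show "hypersimplex_bound (card (S - {i})) \<le> card R''"
          using Suc(1)[OF n[OF i(1)]] 3 i by simp
      qed
      moreover have "hypersimplex_bound (card (S - {i})) + card (c.F i) \<le> card R'"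
      proof (rule c.F_facet_bound[OF i(1)])
        fix R'' assume "slack_factorization (S - {i}) (card S - k) R'' b a (\<lambda>r v. h r (S - v))"
        then show "hypersimplex_bound (card (S - {i})) \<le> card R''"
          using Suc(1)[OF n[OF i(1)]] 3 i by simp
      qed
      ultimately show ?thesis using i step[OF i(1)] by linarith
    next
      case False
      then have "2 * card S \<le> card R'" using 3 by (intro card_ge_if_rows_le_two) force+
      then show ?thesis using 3 by (simp add: hypersimplex_bound_def)
    qed
    then show ?thesis
      using card_mono[OF slack_factorizationD(2)[OF Suc.prems(1)] R'(1)] by linarith
  qed
qed simp

subsection \<open>Facets and slack functionals\<close>

lemma affine_map_add: "affine_map f \<Longrightarrow> affine_map g \<Longrightarrow> affine_map (\<lambda>x. f x + g x)"
proof -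
  assume "affine_map f" "affine_map g"
  then obtain A b A' b' where "linear A" "f = (\<lambda>x. A x + b)" "linear A'" "g = (\<lambda>x. A' x + b')"
    unfolding affine_map_def by auto
  then show ?thesis unfolding affine_map_def
    by (intro exI[of _ "\<lambda>x. A x + A' x"] exI[of _ "b + b'"]) (auto simp: linear_compose_add)
qed

lemma affine_map_compose: "affine_map f \<Longrightarrow> affine_map g \<Longrightarrow> affine_map (\<lambda>x. f (g x))"
proof -
  assume "affine_map f" "affine_map g"
  then obtain A b A' b' where "linear A" "f = (\<lambda>x. A x + b)" "linear A'" "g = (\<lambda>x. A' x + b')"
    unfolding affine_map_def by auto
  then show ?thesis unfolding affine_map_def
    by (intro exI[of _ "\<lambda>x. A (A' x)"] exI[of _ "A b' + b"])
      (auto simp: linear_add linear_compose[of A' A, unfolded o_def])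
qed

lemma affine_map_linear: "linear f \<Longrightarrow> affine_map f"
  unfolding affine_map_def by (intro exI[of _ f] exI[of _ 0]) simp

lemma affine_map_const: "affine_map (\<lambda>x. c)"
  unfolding affine_map_def by (intro exI[of _ "\<lambda>x. 0"] exI[of _ c]) (simp add: linear_zero)

lemma affine_map_scaleR: "affine_map f \<Longrightarrow> affine_map (\<lambda>x. c *\<^sub>R f x)"
  using affine_map_compose[of "\<lambda>y. c *\<^sub>R y" f] by (simp add: affine_map_linear)

lemma affine_map_diff: "affine_map f \<Longrightarrow> affine_map g \<Longrightarrow> affine_map (\<lambda>x. f x - g x)"
  using affine_map_add[of f "\<lambda>x. (-1) *\<^sub>R g x"] affine_map_scaleR[of g "-1"] by simp

lemma affine_map_mult: "affine_map f \<Longrightarrow> affine_map (\<lambda>x. c * (f x :: real))"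
  using affine_map_scaleR[of f c] by simp

lemma affine_map_sum:
  "(\<And>i. i \<in> I \<Longrightarrow> affine_map (f i)) \<Longrightarrow> affine_map (\<lambda>x. \<Sum>i\<in>I. f i x)"
  by (induction I rule: infinite_finite_induct) (auto intro: affine_map_const affine_map_add)

lemma affine_map_comb:
  assumes "affine_map f" "u + v = 1"
  shows "f (u *\<^sub>R x + v *\<^sub>R y) = u *\<^sub>R f x + v *\<^sub>R f y"
proof -
  obtain A b where A: "linear A" "f = (\<lambda>x. A x + b)" using assms by (auto simp: affine_map_def)
  have "b = u *\<^sub>R b + v *\<^sub>R b" using assms(2) by (simp flip: scaleR_left_distrib)
  then show ?thesis using A by (simp add: linear_add linear_scale algebra_simps)
qed

lemma affine_map_sum_comb:
  assumes "affine_map f" "finite W" "sum u W = 1"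
  shows "f (\<Sum>w\<in>W. u w *\<^sub>R g w) = (\<Sum>w\<in>W. u w *\<^sub>R f (g w))"
proof -
  obtain A b where A: "linear A" "f = (\<lambda>x. A x + b)" using assms by (auto simp: affine_map_def)
  have "b = (\<Sum>w\<in>W. u w *\<^sub>R b)" using assms(3) by (simp flip: scaleR_sum_left)
  then show ?thesis using A by (simp add: linear_sum linear_scale algebra_simps sum.distrib)
qed

lemma affine_map_nonneg_hull:
  fixes f :: "'a::real_vector \<Rightarrow> real"
  assumes "affine_map f" "\<And>v. v \<in> V \<Longrightarrow> 0 \<le> f v" "x \<in> convex hull V"
  shows "0 \<le> f x"
proof -
  have "convex {x. 0 \<le> f x}"
    using affine_map_comb[OF assms(1)] by (intro convexI) auto
  then have "convex hull V \<subseteq> {x. 0 \<le> f x}" using assms(2) by (intro hull_minimal) auto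
  then show ?thesis using assms(3) by blast
qed

lemma affine_map_zero_affine_hull:
  assumes "affine_map f" "\<And>v. v \<in> V \<Longrightarrow> f v = 0" "x \<in> affine hull V"
  shows "f x = 0"
proof -
  have "affine {x. f x = 0}"
    using affine_map_comb[OF assms(1)] by (auto simp: affine_def)
  then have "affine hull V \<subseteq> {x. f x = 0}" using assms(2) by (intro hull_minimal) auto
  then show ?thesis using assms(3) by blast
qed

section \<open>Affine independence and dimension\<close>

lemma affine_independent_card_le:
  fixes B T :: "'a::real_vector set"
  assumes "finite T" "finite B" "\<not> affine_dependent B" "B \<subseteq> affine hull T"
  shows "card B \<le> card T"
proof (cases "B = {}")
  case False
  then have "T \<noteq> {}" using assms(4) by auto
  then obtain t b where t: "t \<in> T" and b: "b \<in> B" using False by blast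
  let ?S = "span ((\<lambda>x. - t + x) ` (T - {t}))"
  have "- b + x \<in> ?S" if "x \<in> B" for x
  proof -
    have "x \<in> (\<lambda>x. t + x) ` ?S" "b \<in> (\<lambda>x. t + x) ` ?S"
      using assms(4) that b affine_hull_span2[OF t] by auto
    then obtain p q where "p \<in> ?S" "q \<in> ?S" "x = t + p" "b = t + q" by blast
    then show ?thesis using span_diff[of p _ q] by simp
  qed
  then have "(\<lambda>x. - b + x) ` (B - {b}) \<subseteq> ?S" by blast
  moreover have "independent ((\<lambda>x. - b + x) ` (B - {b}))"
    using assms(3) affine_dependent_iff_dependent2[OF b] by blast
  moreover have "finite ((\<lambda>x. - t + x) ` (T - {t}))" using assms(1) by simp
  ultimately have "card ((\<lambda>x. - b + x) ` (B - {b})) \<le> card ((\<lambda>x. - t + x) ` (T - {t}))"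
    using independent_span_bound by metis
  then have "card (B - {b}) \<le> card (T - {t})"
    by (simp add: card_image)
  then show ?thesis using t b assms(1,2) by (simp add: card_Diff_singleton_if)
      (metis One_nat_def Suc_pred card_gt_0_iff empty_iff Suc_le_mono)
qed simp

text \<open>Two affine bases of the same hull lie in each other's hulls and so have equal size; this
  determines the choice in \<open>adim\<close>.\<close>

lemma adim_eq:
  fixes V :: "'a::real_vector set"
  assumes "finite B" "\<not> affine_dependent B" "affine hull B = affine hull V"
  shows "adim V = int (card B) - 1"
  unfolding adim_def
proof (rule some_equality)
  show "\<exists>B'. finite B' \<and> affine hull B' = affine hull V \<and> \<not> affine_dependent B' \<and> int (card B') = int (card B) - 1 + 1"
    using assms by auto
  fix d assume "\<exists>B'. finite B' \<and> affine hull B' = affine hull V \<and> \<not> affine_dependent B' \<and> int (card B') = d + 1"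
  then obtain B' where B': "finite B'" "affine hull B' = affine hull V" "\<not> affine_dependent B'" "int (card B') = d + 1"
    by blast
  have "B \<subseteq> affine hull B'" "B' \<subseteq> affine hull B"
    using assms(3) B'(2) hull_subset by metis+
  then have "card B \<le> card B'" "card B' \<le> card B"
    using assms B' affine_independent_card_le by metis+
  then show "d = int (card B) - 1" using B'(4) by simp
qed

lemma affine_functional_exists:
  assumes "\<not> affine_dependent (insert v B)" "v \<notin> B" "b \<in> B"
  shows "\<exists>g :: 'a::real_vector \<Rightarrow> real. affine_map g \<and> (\<forall>x\<in>B. g x = 0) \<and> g v = 1"
proof -
  have b: "b \<in> insert v B" using assms(3) by simp
  have "independent ((\<lambda>x. - b + x) ` (insert v B - {b}))"
    using assms(1) iffD2[OF affine_dependent_iff_dependent2[OF b]] by (rule contrapos_nn)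
  then obtain g :: "'a \<Rightarrow> real" where g: "linear g"
      "\<forall>x\<in>(\<lambda>x. - b + x) ` (insert v B - {b}). g x = (if x = - b + v then 1 else 0)"
    using linear_independent_extend[of _ "\<lambda>x. if x = - b + v then 1 else 0"] by blast
  define G where "G x = g (- b + x)" for x
  have "affine_map G"
    unfolding affine_map_def G_def using g(1)
    by (intro exI[of _ g] exI[of _ "- g b"]) (simp add: linear_diff)
  moreover have "G x = 0" if "x \<in> B" for x
    using g that assms by (cases "x = b") (auto simp: G_def linear_0)
  moreover have "v \<in> insert v B - {b}" using assms by auto
  then have "G v = 1" using g(2) by (simp add: G_def)
  ultimately show ?thesis by blast
qed

lemma affine_independent_insert_point:
  fixes B :: "'a::real_vector set"
  assumes "\<not> affine_dependent B" "v \<notin> affine hull B"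
  shows "\<not> affine_dependent (insert v B)"
proof (cases "B = {}")
  case False
  then obtain b where b: "b \<in> B" by blast
  have vB: "v \<notin> B" using assms(2) hull_inc[of v B affine] by blast
  then have "insert v B - {b} = insert v (B - {b})" using b by auto
  then have eq: "(\<lambda>x. - b + x) ` (insert v B - {b}) = insert (- b + v) ((\<lambda>x. - b + x) ` (B - {b}))"
    by (simp only: image_insert)
  have "- b + v \<notin> span ((\<lambda>x. - b + x) ` (B - {b}))"
  proof
    assume "- b + v \<in> span ((\<lambda>x. - b + x) ` (B - {b}))"
    then have "b + (- b + v) \<in> affine hull B" unfolding affine_hull_span2[OF b] by blast
    then show False using assms(2) by simp
  qed
  moreover have "independent ((\<lambda>x. - b + x) ` (B - {b}))"
    using assms(1) affine_dependent_iff_dependent2[OF b] by blast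
  ultimately have "independent ((\<lambda>x. - b + x) ` (insert v B - {b}))"
    unfolding eq by (simp add: independent_insert)
  moreover have b': "b \<in> insert v B" using b by simp
  ultimately show ?thesis
    using iffD1[OF affine_dependent_iff_dependent2[OF b']] by (metis (no_types))
qed simp

section \<open>Functionals of minimal support\<close>

definition supp_on :: "'a set \<Rightarrow> ('a \<Rightarrow> real) \<Rightarrow> 'a set"
  where "supp_on V f = {v \<in> V. f v \<noteq> 0}"

text \<open>An algebraic form of the extreme rays of the cone of affine functionals nonnegative on
  \<open>V\<close>, taken modulo functionals that vanish on \<open>V\<close>.\<close>

definition extreme_functional :: "'a::real_vector set \<Rightarrow> ('a \<Rightarrow> real) \<Rightarrow> bool"
  where "extreme_functional V f \<longleftrightarrow> affine_map f \<and> (\<forall>v\<in>V. 0 \<le> f v) \<and> supp_on V f \<noteq> {} \<and>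
    (\<forall>g. affine_map g \<longrightarrow> (\<forall>v\<in>V. 0 \<le> g v) \<longrightarrow> \<not> (supp_on V g \<noteq> {} \<and> supp_on V g \<subset> supp_on V f))"

lemma extreme_functional_exists:
  assumes "finite V" "affine_map f" "\<forall>v\<in>V. 0 \<le> f v" "supp_on V f \<noteq> {}"
  shows "\<exists>g. extreme_functional V g \<and> supp_on V g \<subseteq> supp_on V f"
  using assms(2-)
proof (induction "card (supp_on V f)" arbitrary: f rule: less_induct)
  case less
  show ?case
  proof (cases "extreme_functional V f")
    case False
    then obtain g where g: "affine_map g" "\<forall>v\<in>V. 0 \<le> g v" "supp_on V g \<noteq> {}" "supp_on V g \<subset> supp_on V f"
      using less.prems unfolding extreme_functional_def by blast
    have "finite (supp_on V f)" using assms(1) by (simp add: supp_on_def)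
    then have "card (supp_on V g) < card (supp_on V f)" using g(4) psubset_card_mono by blast
    then show ?thesis using less.hyps[of g] g by blast
  qed blast
qed

text \<open>Subtract from \<open>g\<close> the largest multiple of \<open>f\<close> that keeps it nonnegative on the support
  of \<open>f\<close>.\<close>

lemma subtract_ratio:
  fixes f g :: "'a::real_vector \<Rightarrow> real"
  assumes "finite V" "\<forall>v\<in>V. 0 \<le> f v" "supp_on V f \<noteq> {}"
  obtains c v0 where "v0 \<in> supp_on V f" "g v0 = c * f v0" "\<And>v. v \<in> supp_on V f \<Longrightarrow> c * f v \<le> g v"
    "c = g v0 / f v0"
proof -
  have fin: "finite (supp_on V f)" using assms(1) by (simp add: supp_on_def)
  define c where "c = Min ((\<lambda>v. g v / f v) ` supp_on V f)"
  have "c \<in> (\<lambda>v. g v / f v) ` supp_on V f"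
    unfolding c_def using fin assms(3) by (intro Min_in) auto
  then obtain v0 where v0: "v0 \<in> supp_on V f" "c = g v0 / f v0" by blast
  have "c * f v \<le> g v" if "v \<in> supp_on V f" for v
  proof -
    have "c \<le> g v / f v" unfolding c_def using fin that by (intro Min_le) auto
    moreover have "0 < f v" using assms(2) that by (auto simp: supp_on_def order_less_le)
    ultimately show ?thesis by (simp add: pos_le_divide_eq)
  qed
  with v0 show ?thesis by (intro that[of v0 c]) (auto simp: supp_on_def)
qed

text \<open>Subtracting the largest admissible multiple of \<open>f\<close> from \<open>g\<close>
  leaves a nonnegative functional of strictly smaller support, which must vanish on \<open>V\<close>
  by minimality. The sign of \<open>g\<close> is unrestricted.\<close>

lemma extreme_functional_unique:
  assumes "finite V" and f: "extreme_functional V f"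
    and g: "affine_map g" "\<And>v. v \<in> V \<Longrightarrow> f v = 0 \<Longrightarrow> g v = 0"
  shows "\<exists>c. \<forall>v\<in>V. g v = c * f v"
proof -
  obtain c v0 where c: "v0 \<in> supp_on V f" "g v0 = c * f v0" "\<And>v. v \<in> supp_on V f \<Longrightarrow> c * f v \<le> g v"
    using subtract_ratio[of V f g] assms(1) f unfolding extreme_functional_def by metis
  define d where "d = (\<lambda>x. g x - c * f x)"
  have aff: "affine_map d"
    unfolding d_def using g(1) f by (intro affine_map_diff affine_map_mult) (auto simp: extreme_functional_def)
  have nonneg: "\<forall>v\<in>V. 0 \<le> d v"
  proof
    fix v assume "v \<in> V"
    then show "0 \<le> d v" using c(3)[of v] g(2)[of v] by (cases "f v = 0") (auto simp: d_def supp_on_def)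
  qed
  have "supp_on V d \<subset> supp_on V f"
    using c(1,2) g(2) by (auto simp: d_def supp_on_def)
  then have "supp_on V d = {}"
    using f aff nonneg unfolding extreme_functional_def by blast
  then show ?thesis by (intro exI[of _ c]) (auto simp: d_def supp_on_def)
qed

lemma zero_set_face:
  fixes f :: "'a::real_vector \<Rightarrow> real"
  assumes "affine_map f" "\<And>x. x \<in> P \<Longrightarrow> 0 \<le> f x" "convex P"
  shows "{x \<in> P. f x = 0} face_of P"
  unfolding face_of_def
proof (intro conjI ballI impI)
  show "convex {x \<in> P. f x = 0}"
    using assms(3) affine_map_comb[OF assms(1)] by (auto simp: convex_def)
  fix a b x assume "a \<in> P" "b \<in> P" "x \<in> {x \<in> P. f x = 0}" "x \<in> open_segment a b"
  then obtain u where u: "0 < u" "u < 1" "x = (1 - u) *\<^sub>R a + u *\<^sub>R b" "f x = 0"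
    by (auto simp: in_segment)
  have "(1 - u) * f a + u * f b = 0"
    using affine_map_comb[OF assms(1), of "1 - u" u a b] u by simp
  moreover have "0 \<le> f a" "0 \<le> f b" using assms(2) \<open>a \<in> P\<close> \<open>b \<in> P\<close> by auto
  ultimately have "(1 - u) * f a = 0 \<and> u * f b = 0"
    using u by (simp add: add_nonneg_eq_0_iff)
  then show "a \<in> {x \<in> P. f x = 0}" "b \<in> {x \<in> P. f x = 0}"
    using u \<open>a \<in> P\<close> \<open>b \<in> P\<close> by auto
qed auto

text \<open>An affine basis of the zero set and one point \<open>p\<close> off it already span the
  affine hull of \<open>V\<close>: a functional that vanishes on them but not on all of
  \<open>V\<close> would be a multiple of \<open>f\<close>, and its value at \<open>p\<close> makes
  the factor zero. So the dimension drops by exactly one.\<close>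

lemma extreme_functional_facet:
  assumes V: "finite V" and f: "extreme_functional V f" and ne: "\<exists>v\<in>V. f v = 0"
  shows "{x \<in> convex hull V. f x = 0} \<in> facets (convex hull V)"
proof -
  let ?P = "convex hull V" and ?Z = "{v \<in> V. f v = 0}"
  let ?F = "{x \<in> ?P. f x = 0}"
  have aff: "affine_map f" and nn: "\<And>v. v \<in> V \<Longrightarrow> 0 \<le> f v" and s: "supp_on V f \<noteq> {}"
    using f by (auto simp: extreme_functional_def)
  have face: "?F face_of ?P"
    using zero_set_face[OF aff] affine_map_nonneg_hull[OF aff nn] convex_convex_hull by blast
  have FV: "?F \<inter> V = ?Z" using hull_inc[of _ V convex] by auto
  have F_eq: "?F = convex hull ?Z" using face_of_convex_hull_finite[OF V face] FV by simp
  obtain B where B: "B \<subseteq> ?Z" "\<not> affine_dependent B" "affine hull ?Z = affine hull B"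
    using affine_basis_exists by blast
  have finB: "finite B" using B(1) V finite_subset by fastforce
  obtain p where p: "p \<in> V" "f p \<noteq> 0" using s by (auto simp: supp_on_def)
  have fB: "f x = 0" if "x \<in> affine hull B" for x
    using affine_map_zero_affine_hull[OF aff _ that] B(1) by blast
  have pB: "p \<notin> affine hull B" using fB p by blast
  have ind: "\<not> affine_dependent (insert p B)"
    using affine_independent_insert_point[OF B(2) pB] .
  have V_sub: "v \<in> affine hull (insert p B)" if v: "v \<in> V" for v
  proof (rule ccontr)
    assume nv: "v \<notin> affine hull (insert p B)"
    then have "v \<notin> insert p B" using hull_inc by metis
    then obtain g :: "'a \<Rightarrow> real" where g: "affine_map g" "\<forall>x\<in>insert p B. g x = 0" "g v = 1"
      using affine_functional_exists[OF affine_independent_insert_point[OF ind nv], of p] by blast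
    have "g x = 0" if "x \<in> V" "f x = 0" for x
    proof -
      have "x \<in> affine hull B" using that B(3) hull_inc[of x ?Z affine] by auto
      then show ?thesis using affine_map_zero_affine_hull[OF g(1)] g(2) by blast
    qed
    then obtain c where c: "\<forall>v\<in>V. g v = c * f v"
      using extreme_functional_unique[OF V f g(1)] by blast
    then have "c = 0" using g(2) p by fastforce
    then show False using c v g(3) by simp
  qed
  have "affine hull V \<subseteq> affine hull (insert p B)"
    using V_sub by (intro hull_minimal) auto
  moreover have "insert p B \<subseteq> V" using B(1) p by blast
  ultimately have hull_eq: "affine hull (insert p B) = affine hull V"
    using hull_mono[of "insert p B" V affine] by blast
  have "adim ?P = int (card (insert p B)) - 1"
    using adim_eq[of "insert p B" ?P] finB ind hull_eq by simp
  moreover have "adim ?F = int (card B) - 1"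
    using adim_eq[of B ?F] finB B(2,3) unfolding F_eq by simp
  moreover have "card (insert p B) = Suc (card B)"
    using finB pB hull_inc[of p B affine] by (subst card_insert_disjoint) auto
  ultimately have "adim ?F = adim ?P - 1" by simp
  moreover have "?F \<noteq> {}" using ne hull_inc[of _ V convex] by blast
  ultimately show ?thesis using face by (simp add: facets_def)
qed

text \<open>The affine functionals that are nonnegative on a polytope and vanish somewhere on it are
  conical combinations of slack functionals of facets: subtract multiples of functionals of minimal
  support until nothing is left.\<close>

theorem polytope_slack_functionals:
  fixes P :: "'a::real_vector set"
  assumes "polytope P"
  shows "\<exists>s :: 'a set \<Rightarrow> 'a \<Rightarrow> real. (\<forall>F. \<forall>x\<in>P. 0 \<le> s F x) \<and>
    (\<forall>f. affine_map f \<and> (\<forall>x\<in>P. 0 \<le> f x) \<and> (\<exists>x\<in>P. f x = 0) \<longrightarrow>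
      (\<exists>c. (\<forall>F. 0 \<le> c F) \<and> (\<forall>x\<in>P. f x = (\<Sum>F\<in>facets P. c F * s F x))))"
proof -
  obtain V where V: "finite V" "P = convex hull V" using assms by (auto simp: polytope_def)
  have VP: "v \<in> P" if "v \<in> V" for v using that V by (simp add: hull_inc)
  define good where "good F f \<longleftrightarrow> extreme_functional V f \<and> {x \<in> P. f x = 0} = F" for F f
  \<comment> \<open>The choice depends on \<open>F\<close> only, so one functional per facet serves
    all \<open>f\<close>. The default zero keeps \<open>s F\<close> affine and nonnegative for every
    other set.\<close>
  define s where "s F = (if Ex (good F) then Eps (good F) else (\<lambda>x. 0))" for F
  have s_good: "good F (s F)" if "Ex (good F)" for F
    using someI_ex[OF that] that by (simp add: s_def)
  have s_aff: "affine_map (s F)" for F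
  proof (cases "Ex (good F)")
    case True
    then show ?thesis using s_good[OF True] by (simp add: good_def extreme_functional_def)
  next
    case False
    then have "s F = (\<lambda>x. 0)" unfolding s_def by (rule if_not_P)
    then show ?thesis by (simp add: affine_map_const)
  qed
  have s_nonneg: "0 \<le> s F x" if "x \<in> P" for F x
  proof (cases "Ex (good F)")
    case True
    then show ?thesis using s_good[OF True] affine_map_nonneg_hull[OF s_aff, of V F x] that V
      by (auto simp: good_def extreme_functional_def)
  next
    case False
    then have "s F = (\<lambda>x. 0)" unfolding s_def by (rule if_not_P)
    then show ?thesis by simp
  qed
  note finF = finite_facets[OF assms]
  have main: "\<exists>c. (\<forall>F. 0 \<le> c F) \<and> (\<forall>x\<in>V. f x = (\<Sum>F\<in>facets P. c F * s F x))"
    if "affine_map f" "\<forall>v\<in>V. 0 \<le> f v" "\<exists>v\<in>V. f v = 0" for f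
    using that
  proof (induction "card (supp_on V f)" arbitrary: f rule: less_induct)
    case less
    show ?case
    proof (cases "supp_on V f = {}")
      case True
      then show ?thesis by (intro exI[of _ "\<lambda>F. 0"]) (auto simp: supp_on_def)
    next
      case False
      then obtain g where g: "extreme_functional V g" "supp_on V g \<subseteq> supp_on V f"
        using extreme_functional_exists[OF V(1) less.prems(1,2)] by blast
      define F where "F = {x \<in> P. g x = 0}"
      have "\<exists>v\<in>V. g v = 0" using less.prems(3) g(2) by (auto simp: supp_on_def)
      then have F: "F \<in> facets P" unfolding F_def V(2) by (rule extreme_functional_facet[OF V(1) g(1)])
      have sF: "extreme_functional V (s F)" "{x \<in> P. s F x = 0} = F"
        using s_good[OF exI[of _ g]] g(1) unfolding good_def F_def by blast+
      \<comment> \<open>\<open>s F\<close> and \<open>g\<close> vanish at the same points of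
        \<open>V\<close>, so the fixed functional can replace \<open>g\<close>.\<close>
      have zero: "s F v = 0 \<longleftrightarrow> g v = 0" if "v \<in> V" for v
        using sF(2) VP[OF that] unfolding F_def by blast
      then have supp: "supp_on V (s F) = supp_on V g" by (auto simp: supp_on_def)
      have sF': "\<forall>v\<in>V. 0 \<le> s F v" "supp_on V (s F) \<noteq> {}" using sF(1) by (auto simp: extreme_functional_def)
      obtain c v0 where c: "v0 \<in> supp_on V (s F)" "f v0 = c * s F v0"
          "\<And>v. v \<in> supp_on V (s F) \<Longrightarrow> c * s F v \<le> f v" "c = f v0 / s F v0"
        by (rule subtract_ratio[OF V(1) sF', where g = f]) (rule that)
      have "v0 \<in> V" using c(1) by (simp add: supp_on_def)
      then have c0: "0 \<le> c" unfolding c(4) using less.prems(2) sF' by simp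
      define d where "d = (\<lambda>x. f x - c * s F x)"
      have aff: "affine_map d"
        unfolding d_def using less.prems(1) s_aff by (intro affine_map_diff affine_map_mult)
      have off: "d v = f v" if "v \<in> V - supp_on V (s F)" for v
        using that by (auto simp: d_def supp_on_def)
      have "\<forall>v\<in>V. 0 \<le> d v"
        using c(3) off less.prems(2) by (metis DiffI d_def diff_ge_0_iff_ge)
      moreover have sub: "supp_on V d \<subset> supp_on V f"
      proof
        show "supp_on V d \<subseteq> supp_on V f"
          using off supp g(2) by (auto simp: supp_on_def)
        have "v0 \<in> supp_on V f - supp_on V d" using c(1,2) supp g(2) by (auto simp: d_def supp_on_def)
        then show "supp_on V d \<noteq> supp_on V f" by blast
      qed
      moreover have "\<exists>v\<in>V. d v = 0" using less.prems(3) sub by (auto simp: supp_on_def)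
      moreover have "card (supp_on V d) < card (supp_on V f)"
        using sub V(1) by (intro psubset_card_mono) (auto simp: supp_on_def)
      ultimately obtain e where e: "\<forall>F. 0 \<le> e F" "\<forall>x\<in>V. d x = (\<Sum>F\<in>facets P. e F * s F x)"
        using less.hyps[of d] aff by blast
      have "f x = (\<Sum>F'\<in>facets P. (e F' + (if F' = F then c else 0)) * s F' x)" if "x \<in> V" for x
      proof -
        have "(\<Sum>F'\<in>facets P. (e F' + (if F' = F then c else 0)) * s F' x) =
            d x + (\<Sum>F'\<in>facets P. if F' = F then c * s F x else 0)"
          unfolding e(2)[rule_format, OF that] sum.distrib[symmetric]
          by (intro sum.cong) (auto simp: algebra_simps)
        also have "(\<Sum>F'\<in>facets P. if F' = F then c * s F x else 0) = c * s F x"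
          using F finF by simp
        finally show ?thesis by (simp add: d_def)
      qed
      moreover have "\<forall>F'. 0 \<le> e F' + (if F' = F then c else 0)" using e(1) c0 by simp
      ultimately show ?thesis
        by (intro exI[of _ "\<lambda>F'. e F' + (if F' = F then c else 0)"]) blast
    qed
  qed
  show ?thesis
  proof (intro exI[of _ s] conjI allI impI ballI)
    fix f :: "'a \<Rightarrow> real"
    assume "affine_map f \<and> (\<forall>x\<in>P. 0 \<le> f x) \<and> (\<exists>x\<in>P. f x = 0)"
    then have f: "affine_map f" "\<And>x. x \<in> P \<Longrightarrow> 0 \<le> f x" "\<exists>x\<in>P. f x = 0" by auto
    \<comment> \<open>A nonempty face is the hull of its points in \<open>V\<close>, so
      \<open>f\<close> already vanishes at some point of \<open>V\<close>.\<close>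
    have "{x \<in> P. f x = 0} face_of convex hull V"
      using zero_set_face[OF f(1,2)] V(2) by simp
    then have "{x \<in> P. f x = 0} = convex hull ({x \<in> P. f x = 0} \<inter> V)"
      by (rule face_of_convex_hull_finite[OF V(1)])
    moreover have "{x \<in> P. f x = 0} \<noteq> {}" using f(3) by blast
    ultimately have "{x \<in> P. f x = 0} \<inter> V \<noteq> {}" by (metis convex_hull_empty)
    then have "\<exists>v\<in>V. f v = 0" by blast
    then obtain c where c: "\<forall>F. 0 \<le> c F" "\<forall>x\<in>V. f x = (\<Sum>F\<in>facets P. c F * s F x)"
      using main[OF f(1)] f(2) VP by blast
    define d where "d = (\<lambda>x. f x - (\<Sum>F\<in>facets P. c F * s F x))"
    have "affine_map d"
      unfolding d_def by (intro affine_map_diff affine_map_sum affine_map_mult f(1) s_aff)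
    moreover have "d v = 0" if "v \<in> V" for v using c(2) that by (simp add: d_def)
    ultimately have "d x = 0" if "x \<in> P" for x
      using affine_map_zero_affine_hull[of d V x] that V(2) convex_hull_subset_affine_hull[of V] by blast
    then show "\<exists>c. (\<forall>F. 0 \<le> c F) \<and> (\<forall>x\<in>P. f x = (\<Sum>F\<in>facets P. c F * s F x))"
      using c(1) by (intro exI[of _ c]) (simp add: d_def)
  qed (rule s_nonneg)
qed

subsection \<open>Polytopes given by inequalities\<close>

lemma affine_map_reflect: "affine_map f \<Longrightarrow> f (p + e *\<^sub>R (p - q)) = f p + e *\<^sub>R (f p - f q)"
proof -
  assume "affine_map f"
  then obtain A b where "linear A" "f = (\<lambda>x. A x + b)" by (auto simp: affine_map_def)
  then show ?thesis by (simp add: linear_add linear_diff linear_scale)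
qed

lemma affine_reflect:
  assumes "affine X" "p \<in> X" "q \<in> X" shows "p + e *\<^sub>R (p - q) \<in> X"
proof -
  have "(1 + e) *\<^sub>R p + (- e) *\<^sub>R q \<in> X" using assms by (intro mem_affine) auto
  then show ?thesis by (simp add: algebra_simps)
qed

lemma in_open_segment_reflect:
  fixes p q :: "'a::real_vector"
  assumes "0 < e" "q \<noteq> p"
  shows "p \<in> open_segment q (p + e *\<^sub>R (p - q))"
proof -
  define t where "t = 1 / (1 + e)"
  have t: "0 < t" "t < 1" "t * (1 + e) = 1" using assms by (auto simp: t_def)
  have "(1 - t) *\<^sub>R q + t *\<^sub>R (p + e *\<^sub>R (p - q)) = (t * (1 + e)) *\<^sub>R p + (1 - t * (1 + e)) *\<^sub>R q"
    by (simp add: algebra_simps)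
  then have "p = (1 - t) *\<^sub>R q + t *\<^sub>R (p + e *\<^sub>R (p - q))" using t(3) by simp
  moreover have "q \<noteq> p + e *\<^sub>R (p - q)"
  proof
    assume "q = p + e *\<^sub>R (p - q)"
    then have "(1 + e) *\<^sub>R (p - q) = 0" by (simp add: algebra_simps)
    then show False using assms by simp
  qed
  ultimately show ?thesis using t unfolding in_segment by blast
qed

text \<open>The barycenter replaces a point of the relative interior: by
  \<open>average_reflect\<close> a segment from a point of the affine hull to it can be prolonged
  within the convex hull.\<close>

definition average :: "'a::real_vector set \<Rightarrow> 'a"
  where "average W = (\<Sum>w\<in>W. (1 / real (card W)) *\<^sub>R w)"

lemma average_weights: "finite W \<Longrightarrow> W \<noteq> {} \<Longrightarrow> (\<Sum>w\<in>W. 1 / real (card W)) = 1"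
  by simp

lemma average_in_hull: "finite W \<Longrightarrow> W \<noteq> {} \<Longrightarrow> average W \<in> convex hull W"
  unfolding average_def
  by (intro convex_sum convex_convex_hull) (auto simp: hull_inc)

lemma average_reflect:
  fixes W :: "'a::real_vector set"
  assumes W: "finite W" "W \<noteq> {}" and q: "q \<in> affine hull W"
  shows "\<exists>e>0. average W + e *\<^sub>R (average W - q) \<in> convex hull W"
proof -
  obtain u where u: "sum u W = 1" "(\<Sum>w\<in>W. u w *\<^sub>R w) = q"
    using q unfolding affine_hull_finite[OF W(1)] by blast
  define m where "m = 1 / real (card W)"
  have m: "0 < m" "m \<le> 1" using W by (auto simp: m_def Suc_le_eq card_gt_0_iff)
  define K where "K = 1 + (\<Sum>w\<in>W. \<bar>u w\<bar>)"
  have "0 \<le> (\<Sum>w\<in>W. \<bar>u w\<bar>)" by (intro sum_nonneg) auto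
  then have K: "0 < K" unfolding K_def by linarith
  \<comment> \<open>\<open>K\<close> bounds every \<open>u w - m\<close>, so this \<open>e\<close>
    keeps the new weights \<open>m + e * (m - u w)\<close> nonnegative.\<close>
  define e where "e = m / K"
  have e: "0 < e" using m K by (simp add: e_def)
  have coeff: "0 \<le> m + e * (m - u w)" if "w \<in> W" for w
  proof -
    have "\<bar>u w\<bar> \<le> (\<Sum>w\<in>W. \<bar>u w\<bar>)" using W(1) that by (intro member_le_sum) auto
    then have "u w - m \<le> K" using m by (simp add: K_def)
    then have "e * (u w - m) \<le> e * K" using e by (intro mult_left_mono) auto
    also have "\<dots> = m" using K by (simp add: e_def)
    finally show ?thesis by (simp add: algebra_simps)
  qed
  have sm: "(\<Sum>w\<in>W. m) = 1" using average_weights[OF W] by (simp add: m_def)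
  have "average W + e *\<^sub>R (average W - q) = (\<Sum>w\<in>W. (m + e * (m - u w)) *\<^sub>R w)"
    unfolding average_def m_def[symmetric] u(2)[symmetric] sum_subtractf[symmetric] scaleR_sum_right
      sum.distrib[symmetric]
    by (intro sum.cong refl) (simp add: algebra_simps)
  moreover have "(\<Sum>w\<in>W. m + e * (m - u w)) = 1"
    unfolding sum.distrib sum_distrib_left[symmetric] sum_subtractf sm u(1) by simp
  ultimately have "average W + e *\<^sub>R (average W - q) \<in> convex hull W"
    using W(1) coeff by (auto intro!: convex_sum convex_convex_hull simp: hull_inc)
  then show ?thesis using e by blast
qed

text \<open>Prolong the segment from \<open>q\<close> through the barycenter of \<open>W\<close>
  inside \<open>F\<close>; the barycenter is then interior to a segment in \<open>P\<close>, so the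
  end \<open>q\<close> lies in the face.\<close>

lemma face_contains_affine_hull:
  assumes face: "F face_of P" and W: "finite W" "F = convex hull W"
    and q: "q \<in> P" "q \<in> affine hull W"
  shows "q \<in> F"
proof (cases "q = average W")
  case True
  moreover have "W \<noteq> {}" using q by auto
  ultimately show ?thesis using average_in_hull W by simp
next
  case False
  have ne: "W \<noteq> {}" using q by auto
  obtain e where e: "0 < e" "average W + e *\<^sub>R (average W - q) \<in> F"
    using average_reflect[OF W(1) ne q(2)] W(2) by blast
  have "average W \<in> F" using average_in_hull[OF W(1) ne] W(2) by simp
  moreover have "average W + e *\<^sub>R (average W - q) \<in> P" using e(2) face_of_imp_subset[OF face] by blast
  ultimately show ?thesis
    using face_ofD[OF face in_open_segment_reflect[OF e(1) False]] q(1) by blast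
qed

text \<open>A zero of \<open>f\<close> in \<open>P\<close> outside \<open>F\<close>, followed by
  \<open>q\<close>, would extend an affine basis of \<open>F\<close> by two independent points, but
  the dimension of \<open>P\<close> allows only one.\<close>

lemma facet_eq_zero_set:
  fixes f :: "'a::real_vector \<Rightarrow> real"
  assumes P: "polytope P" and F: "F \<in> facets P" and f: "affine_map f" "\<And>x. x \<in> F \<Longrightarrow> f x = 0"
    and q: "q \<in> P" "f q \<noteq> 0"
  shows "F = {x \<in> P. f x = 0}"
proof -
  obtain V where V: "finite V" "P = convex hull V" using P by (auto simp: polytope_def)
  have face: "F face_of P" "F \<noteq> {}" "adim F = adim P - 1" using F by (auto simp: facets_def)
  define W where "W = F \<inter> V"
  have W: "finite W" "F = convex hull W"
    using V face_of_convex_hull_finite[OF V(1)] face(1) by (auto simp: W_def)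
  obtain B where B: "B \<subseteq> W" "\<not> affine_dependent B" "affine hull W = affine hull B"
    using affine_basis_exists by blast
  have finB: "finite B" using B(1) W(1) finite_subset by blast
  obtain B' where B': "B' \<subseteq> V" "\<not> affine_dependent B'" "affine hull V = affine hull B'"
    using affine_basis_exists by blast
  have finB': "finite B'" using B'(1) V(1) finite_subset by blast
  have dimF: "adim F = int (card B) - 1" using adim_eq[OF finB B(2)] B(3) W(2) by simp
  have dimP: "adim P = int (card B') - 1" using adim_eq[OF finB' B'(2)] B'(3) V(2) by simp
  have P_hull: "P \<subseteq> affine hull B'" using V(2) B'(3) convex_hull_subset_affine_hull by metis
  have FP: "F \<subseteq> P" using face(1) face_of_imp_subset by blast
  have "x \<in> F" if x: "x \<in> P" "f x = 0" for x
  proof (rule ccontr)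
    assume "x \<notin> F"
    then have xB: "x \<notin> affine hull B"
      using face_contains_affine_hull[OF face(1) W x(1)] B(3) by blast
    then have ind: "\<not> affine_dependent (insert x B)"
      using affine_independent_insert_point[OF B(2)] by blast
    have "f y = 0" if "y \<in> insert x B" for y
      using that f(2) x(2) B(1) W_def by blast
    then have qB: "q \<notin> affine hull (insert x B)"
      using affine_map_zero_affine_hull[OF f(1), of "insert x B" q] q(2) by blast
    have "\<not> affine_dependent (insert q (insert x B))"
      using affine_independent_insert_point[OF ind qB] .
    moreover have "insert q (insert x B) \<subseteq> affine hull B'"
      using q(1) x(1) B(1) FP P_hull W_def by blast
    ultimately have "card (insert q (insert x B)) \<le> card B'"
      using affine_independent_card_le[OF finB' _, of "insert q (insert x B)"] finB by simp
    moreover have "x \<notin> B" "q \<notin> insert x B"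
      using xB qB hull_inc[of x B affine] hull_inc[of q "insert x B" affine] by blast+
    ultimately show False using dimF dimP face(3) finB by simp
  qed
  then show ?thesis using FP f(2) by blast
qed

text \<open>Each facet is the zero set of a single inequality. If every inequality that vanishes on
  \<open>F\<close> vanished on all of \<open>P\<close>, one could move from the barycenter of
  \<open>F\<close> away from a point \<open>q\<close> of \<open>P\<close> outside \<open>F\<close>
  and stay in \<open>P\<close>, which would put \<open>q\<close> into \<open>F\<close>.\<close>

theorem card_facets_le:
  fixes l :: "'r \<Rightarrow> 'a::real_vector \<Rightarrow> real"
  assumes P: "polytope P" and R: "finite R" and l: "\<And>r. r \<in> R \<Longrightarrow> affine_map (l r)"
    and X: "affine X" and eq: "P = {x \<in> X. \<forall>r\<in>R. 0 \<le> l r x}"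
  shows "card (facets P) \<le> card R"
proof -
  have ex: "\<exists>r\<in>R. (\<forall>x\<in>F. l r x = 0) \<and> (\<exists>q\<in>P. l r q \<noteq> 0)" if F: "F \<in> facets P" for F
  proof (rule ccontr)
    assume no: "\<not> ?thesis"
    have face: "F face_of P" "F \<noteq> {}" "adim F = adim P - 1" using F by (auto simp: facets_def)
    obtain V where V: "finite V" "P = convex hull V" using P by (auto simp: polytope_def)
    define W where "W = F \<inter> V"
    have W: "finite W" "F = convex hull W"
      using V face_of_convex_hull_finite[OF V(1)] face(1) by (auto simp: W_def)
    have Wne: "W \<noteq> {}" using face(2) W(2) by auto
    have FP: "F \<subseteq> P" using face(1) face_of_imp_subset by blast
    have "F \<noteq> P" using face(3) by auto
    then obtain q where q: "q \<in> P" "q \<notin> F" using FP by blast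
    let ?p = "average W"
    have pF: "?p \<in> F" using average_in_hull[OF W(1) Wne] W(2) by simp
    have WP: "W \<subseteq> P" using FP by (auto simp: W_def)
    have pos: "0 < l r ?p \<or> l r q = 0" if r: "r \<in> R" for r
    proof (cases "\<exists>w\<in>W. l r w \<noteq> 0")
      case True
      have nn: "0 \<le> l r w" if "w \<in> W" for w using that WP eq r by blast
      have "l r ?p = (\<Sum>w\<in>W. (1 / real (card W)) * l r w)"
        unfolding average_def using affine_map_sum_comb[OF l[OF r] W(1) average_weights[OF W(1) Wne], of "\<lambda>w. w"] by simp
      moreover have "0 < (\<Sum>w\<in>W. (1 / real (card W)) * l r w)"
      proof -
        obtain w where "w \<in> W" "l r w \<noteq> 0" using True by blast
        then show ?thesis using W(1) nn
          by (intro sum_pos2[of W w]) (auto simp: order_less_le card_gt_0_iff)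
      qed
      ultimately show ?thesis by simp
    next
      case False
      have "F \<subseteq> affine hull W" using W(2) convex_hull_subset_affine_hull by blast
      then have "\<forall>x\<in>F. l r x = 0" using affine_map_zero_affine_hull[OF l[OF r], of W] False by blast
      then show ?thesis using no r q(1) by blast
    qed
    \<comment> \<open>\<open>t r\<close> is a step length that inequality \<open>r\<close> allows;
      the extra 1 in \<open>e\<close> makes the minimum meaningful for empty
      \<open>R\<close>.\<close>
    define t where "t r = (if l r q = 0 then 1 else l r ?p / l r q)" for r
    define e where "e = Min (insert 1 (t ` R))"
    have lq: "0 \<le> l r q" if "r \<in> R" for r using q(1) eq that by blast
    have lp: "0 \<le> l r ?p" if "r \<in> R" for r using pF FP eq that by blast
    have tpos: "0 < t r" if "r \<in> R" for r
      using pos[OF that] lq[OF that] by (auto simp: t_def order_less_le)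
    then have e: "0 < e" using R by (simp add: e_def)
    have "0 \<le> l r (?p + e *\<^sub>R (?p - q))" if r: "r \<in> R" for r
    proof -
      have "e \<le> t r" unfolding e_def using R r by (intro Min_le) auto
      then have "e * l r q \<le> t r * l r q" using lq[OF r] by (rule mult_right_mono)
      also have "\<dots> \<le> l r ?p" using lp[OF r] by (simp add: t_def)
      finally have "0 \<le> l r ?p - e * l r q" by simp
      moreover have "0 \<le> e * l r ?p" using e lp[OF r] by simp
      ultimately show ?thesis unfolding affine_map_reflect[OF l[OF r]] by (simp add: algebra_simps)
    qed
    moreover have "?p + e *\<^sub>R (?p - q) \<in> X" using affine_reflect[OF X] pF FP q(1) eq by blast
    ultimately have "?p + e *\<^sub>R (?p - q) \<in> P" using eq by blast
    moreover have "q \<noteq> ?p" using q(2) pF by blast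
    ultimately have "q \<in> F"
      using face_ofD[OF face(1) in_open_segment_reflect[OF e]] q(1) pF by blast
    then show False using q(2) by blast
  qed
  have "facets P \<subseteq> (\<lambda>r. {x \<in> P. l r x = 0}) ` R"
  proof
    fix F assume F: "F \<in> facets P"
    then obtain r q where r: "r \<in> R" "\<forall>x\<in>F. l r x = 0" "q \<in> P" "l r q \<noteq> 0" using ex by blast
    then have "F = {x \<in> P. l r x = 0}" using facet_eq_zero_set[OF P F l[OF r(1)]] by blast
    then show "F \<in> (\<lambda>r. {x \<in> P. l r x = 0}) ` R" using r(1) by blast
  qed
  then have "card (facets P) \<le> card ((\<lambda>r. {x \<in> P. l r x = 0}) ` R)"
    using R by (intro card_mono) auto
  also have "\<dots> \<le> card R" by (rule card_image_le[OF R])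
  finally show ?thesis .
qed

text \<open>By \<open>pointed\<close>, some inequality decreases in every direction within
  \<open>X\<close>, so no ray stays in \<open>P\<close>. From a point not determined by its tight
  inequalities one can move both ways along a line until a further inequality becomes tight; the
  point lies between the two exits.\<close>

theorem inequalities_vertices:
  fixes l :: "'r \<Rightarrow> 'a::real_vector \<Rightarrow> real"
  assumes R: "finite R" and l: "\<And>r. r \<in> R \<Longrightarrow> affine_map (l r)"
    and X: "affine X" and eq: "P = {x \<in> X. \<forall>r\<in>R. 0 \<le> l r x}"
    and pointed: "\<And>x y. x \<in> X \<Longrightarrow> y \<in> X \<Longrightarrow> x \<noteq> y \<Longrightarrow> \<exists>r\<in>R. l r x < l r y"
    and V: "V = {x \<in> P. \<forall>y\<in>P. (\<forall>r\<in>R. l r x = 0 \<longrightarrow> l r y = 0) \<longrightarrow> y = x}"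
  shows "finite V" "P = convex hull V"
proof -
  have "inj_on (\<lambda>x. {r \<in> R. l r x = 0}) V"
  proof (rule inj_onI)
    fix x y assume xy: "x \<in> V" "y \<in> V" "{r \<in> R. l r x = 0} = {r \<in> R. l r y = 0}"
    then have "\<forall>r\<in>R. l r x = 0 \<longrightarrow> l r y = 0" by blast
    then have "y = x" using xy(1,2) unfolding V by blast
    then show "x = y" by simp
  qed
  moreover have "(\<lambda>x. {r \<in> R. l r x = 0}) ` V \<subseteq> Pow R" by blast
  ultimately show "finite V" using R by (meson finite_Pow_iff inj_on_finite)
  have exit: "\<exists>t>0. x + t *\<^sub>R (x - u) \<in> P \<and>
      card {r \<in> R. l r (x + t *\<^sub>R (x - u)) \<noteq> 0} < card {r \<in> R. l r x \<noteq> 0}"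
    if x: "x \<in> P" and u: "u \<in> X" "u \<noteq> x" "\<And>r. r \<in> R \<Longrightarrow> l r x = 0 \<Longrightarrow> l r u = 0" for x u
  proof -
    have xX: "x \<in> X" and lx: "\<And>r. r \<in> R \<Longrightarrow> 0 \<le> l r x" using x eq by auto
    define D where "D = {r \<in> R. l r x < l r u}"
    have D: "finite D" "D \<noteq> {}" using R pointed[OF xX u(1)] u(2) by (auto simp: D_def)
    \<comment> \<open>The ratio test: the first moment at which a decreasing inequality becomes
      tight.\<close>
    define t where "t = Min ((\<lambda>r. l r x / (l r u - l r x)) ` D)"
    have "t \<in> (\<lambda>r. l r x / (l r u - l r x)) ` D" unfolding t_def using D by (intro Min_in) auto
    then obtain r0 where r0: "r0 \<in> D" "t = l r0 x / (l r0 u - l r0 x)" by blast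
    have r0R: "r0 \<in> R" "l r0 x < l r0 u" using r0(1) by (auto simp: D_def)
    have x0: "0 < l r0 x" using lx[OF r0R(1)] u(3)[OF r0R(1)] r0R(2) by (auto simp: order_less_le)
    then have t: "0 < t" using r0R(2) by (simp add: r0(2))
    let ?z = "x + t *\<^sub>R (x - u)"
    have lz: "l r ?z = l r x + t * (l r x - l r u)" if "r \<in> R" for r
      using affine_map_reflect[OF l[OF that]] by simp
    have "0 \<le> l r ?z" if r: "r \<in> R" for r
    proof (cases "r \<in> D")
      case True
      then have "t \<le> l r x / (l r u - l r x)" unfolding t_def using D by (intro Min_le) auto
      then have "t * (l r u - l r x) \<le> l r x" using True by (simp add: D_def pos_le_divide_eq)
      then show ?thesis unfolding lz[OF r] by (simp add: algebra_simps)
    next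
      case False
      then have "0 \<le> t * (l r x - l r u)" using r t by (auto simp: D_def)
      then show ?thesis unfolding lz[OF r] using lx[OF r] by simp
    qed
    then have zP: "?z \<in> P" using affine_reflect[OF X xX u(1)] eq by blast
    have "t * (l r0 u - l r0 x) = l r0 x" using r0R(2) by (simp add: r0(2))
    then have "l r0 ?z = 0" unfolding lz[OF r0R(1)] by (simp add: algebra_simps)
    moreover have "l r ?z = 0" if "r \<in> R" "l r x = 0" for r using lz[OF that(1)] u(3)[OF that] that by simp
    ultimately have "{r \<in> R. l r ?z \<noteq> 0} \<subset> {r \<in> R. l r x \<noteq> 0}" using r0R(1) x0 by auto
    then have "card {r \<in> R. l r ?z \<noteq> 0} < card {r \<in> R. l r x \<noteq> 0}"
      using R by (intro psubset_card_mono) auto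
    then show ?thesis using t zP by blast
  qed
  have "x \<in> convex hull V" if "x \<in> P" for x
    using that
  proof (induction "card {r \<in> R. l r x \<noteq> 0}" arbitrary: x rule: less_induct)
    case less
    show ?case
    proof (cases "x \<in> V")
      case False
      then obtain y where y: "y \<in> P" "\<forall>r\<in>R. l r x = 0 \<longrightarrow> l r y = 0" "y \<noteq> x"
        using less.prems unfolding V by blast
      have xX: "x \<in> X" "y \<in> X" using less.prems y(1) eq by auto
      \<comment> \<open>The reflection of \<open>y\<close> in \<open>x\<close> yields the exit in
        the opposite direction. It may lie outside \<open>P\<close>, but \<open>exit\<close> only
        needs it in \<open>X\<close>.\<close>
      define u where "u = x + 1 *\<^sub>R (x - y)"
      have u: "u \<in> X" unfolding u_def by (rule affine_reflect[OF X xX])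
      have ux: "u \<noteq> x" using y(3) by (simp add: u_def)
      have lu: "l r u = 0" if "r \<in> R" "l r x = 0" for r
        unfolding u_def affine_map_reflect[OF l[OF that(1)]] using that y(2) by simp
      obtain s where s: "0 < s" "x + s *\<^sub>R (x - y) \<in> convex hull V"
        using exit[OF less.prems xX(2) y(3)] y(2) less.hyps by blast
      obtain t where t: "0 < t" "x + t *\<^sub>R (x - u) \<in> convex hull V"
        using exit[OF less.prems u ux] lu less.hyps by blast
      have "(t / (s + t)) *\<^sub>R (x + s *\<^sub>R (x - y)) + (s / (s + t)) *\<^sub>R (x + t *\<^sub>R (x - u)) \<in> convex hull V"
        using s t by (intro convexD[OF convex_convex_hull]) (auto simp: add_divide_distrib[symmetric])
      also have "(t / (s + t)) *\<^sub>R (x + s *\<^sub>R (x - y)) + (s / (s + t)) *\<^sub>R (x + t *\<^sub>R (x - u)) =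
          (t / (s + t) + s / (s + t)) *\<^sub>R x + (t / (s + t) * s - s / (s + t) * t) *\<^sub>R (x - y)"
        unfolding u_def by (simp add: algebra_simps)
      also have "\<dots> = x" using s t by (simp add: add_divide_distrib[symmetric] add.commute[of t s])
      finally show ?thesis .
    qed (simp add: hull_inc)
  qed
  moreover have "convex P"
  proof (rule convexI)
    fix x y u v assume xy: "x \<in> P" "y \<in> P" and uv: "0 \<le> (u::real)" "0 \<le> v" "u + v = 1"
    have "u *\<^sub>R x + v *\<^sub>R y \<in> X" using X xy uv eq by (auto intro!: mem_affine)
    moreover have "0 \<le> l r (u *\<^sub>R x + v *\<^sub>R y)" if r: "r \<in> R" for r
      using affine_map_comb[OF l[OF r] uv(3)] xy uv eq r by simp
    ultimately show "u *\<^sub>R x + v *\<^sub>R y \<in> P" using eq by blast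
  qed
  then have "convex hull V \<subseteq> P" using V by (intro hull_minimal) auto
  ultimately show "P = convex hull V" by blast
qed

subsection \<open>Extensions of hypersimplices\<close>

abbreviation lk :: "(nat \<Rightarrow>\<^sub>0 real) \<Rightarrow> nat \<Rightarrow> real" where "lk \<equiv> Poly_Mapping.lookup"

definition indicator_vec :: "nat set \<Rightarrow> (nat \<Rightarrow>\<^sub>0 real)"
  where "indicator_vec v = (\<Sum>i\<in>v. unit_vec i)"

lemma lookup_indicator_vec: "finite v \<Longrightarrow> lk (indicator_vec v) i = of_bool (i \<in> v)"
  by (auto simp: indicator_vec_def lookup_sum lookup_single when_def)

lemma euclid_iff: "x \<in> euclid n \<longleftrightarrow> (\<forall>i\<ge>n. lk x i = 0)"
  by (auto simp: euclid_def in_keys_iff subset_iff not_less[symmetric])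

lemma affine_map_lookup: "affine_map (\<lambda>x. lk x i)"
  by (intro affine_map_linear linear_lookup)

lemma affine_euclid_slice: "affine {x \<in> euclid m. (\<Sum>i<n. lk x i) = c}"
  unfolding affine_def
proof (intro ballI allI impI)
  fix x y u v assume xy: "x \<in> {x \<in> euclid m. (\<Sum>i<n. lk x i) = c}" "y \<in> {x \<in> euclid m. (\<Sum>i<n. lk x i) = c}"
    and uv: "u + v = (1 :: real)"
  have "(\<Sum>i<n. lk (u *\<^sub>R x + v *\<^sub>R y) i) = u * (\<Sum>i<n. lk x i) + v * (\<Sum>i<n. lk y i)"
    by (simp add: lookup_add sum.distrib sum_distrib_left)
  also have "\<dots> = (u + v) * c" using xy by (simp add: distrib_right)
  finally show "u *\<^sub>R x + v *\<^sub>R y \<in> {x \<in> euclid m. (\<Sum>i<n. lk x i) = c}"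
    using xy uv by (simp add: euclid_iff lookup_add)
qed

lemma vertex_set_eq:
  "{x \<in> euclid n. (\<forall>i<n. lk x i \<in> {0, 1}) \<and> (\<Sum>i<n. lk x i) = real k} =
    indicator_vec ` {v. v \<subseteq> {..<n} \<and> card v = k}"
proof (intro equalityI subsetI)
  fix x assume x: "x \<in> {x \<in> euclid n. (\<forall>i<n. lk x i \<in> {0, 1}) \<and> (\<Sum>i<n. lk x i) = real k}"
  define v where "v = {i. i < n \<and> lk x i = 1}"
  have fin: "finite v" by (simp add: v_def)
  have val: "lk x i = of_bool (i \<in> v)" for i
    using x by (cases "i < n") (auto simp: v_def euclid_iff)
  have "real k = (\<Sum>i<n. of_bool (i \<in> v))" using x val by simp
  also have "\<dots> = real (card ({..<n} \<inter> v))" by simp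
  also have "{..<n} \<inter> v = v" by (auto simp: v_def)
  finally have "card v = k" by simp
  moreover have "x = indicator_vec v"
    by (rule poly_mapping_eqI) (simp add: val lookup_indicator_vec fin)
  moreover have "v \<subseteq> {..<n}" by (auto simp: v_def)
  ultimately show "x \<in> indicator_vec ` {v. v \<subseteq> {..<n} \<and> card v = k}" by blast
next
  fix x assume "x \<in> indicator_vec ` {v. v \<subseteq> {..<n} \<and> card v = k}"
  then obtain v where v: "v \<subseteq> {..<n}" "card v = k" "x = indicator_vec v" by blast
  have fin: "finite v" using v(1) finite_subset by blast
  have "(\<Sum>i<n. of_bool (i \<in> v)) = real (card ({..<n} \<inter> v))" by simp
  also have "{..<n} \<inter> v = v" using v(1) by blast
  finally show "x \<in> {x \<in> euclid n. (\<forall>i<n. lk x i \<in> {0, 1}) \<and> (\<Sum>i<n. lk x i) = real k}"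
    using v fin by (auto simp: lookup_indicator_vec euclid_iff)
qed

lemma hypersimplex_indicator_vecs:
  "hypersimplex n k = convex hull (indicator_vec ` {v. v \<subseteq> {..<n} \<and> card v = k})"
  unfolding hypersimplex_def vertex_set_eq ..

lemma indicator_vec_in_hypersimplex:
  "v \<subseteq> {..<n} \<Longrightarrow> card v = k \<Longrightarrow> indicator_vec v \<in> hypersimplex n k"
  unfolding hypersimplex_indicator_vecs by (intro hull_inc) blast

definition box_ineq :: "nat \<times> bool \<Rightarrow> (nat \<Rightarrow>\<^sub>0 real) \<Rightarrow> real"
  where "box_ineq r x = (if snd r then lk x (fst r) else 1 - lk x (fst r))"

lemma affine_map_box_ineq: "affine_map (box_ineq r)"
  unfolding box_ineq_def
  by (cases "snd r") (simp_all add: affine_map_lookup affine_map_diff affine_map_const)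

text \<open>Points of \<open>?V\<close> have no fractional coordinate: the sum is an integer, so a
  fractional coordinate has a fractional companion, and a small transfer between the two keeps all
  tight inequalities tight.\<close>

lemma hypersimplex_eq:
  "hypersimplex n k = {x \<in> euclid n. (\<Sum>i<n. lk x i) = real k \<and> (\<forall>i<n. 0 \<le> lk x i \<and> lk x i \<le> 1)}"
    (is "_ = ?P")
proof (rule antisym)
  let ?X = "{x \<in> euclid n. (\<Sum>i<n. lk x i) = real k}"
  let ?R = "{..<n} \<times> (UNIV :: bool set)"
  let ?V = "{x \<in> ?P. \<forall>y\<in>?P. (\<forall>r\<in>?R. box_ineq r x = 0 \<longrightarrow> box_ineq r y = 0) \<longrightarrow> y = x}"
  have P_eq: "?P = {x \<in> ?X. \<forall>r\<in>?R. 0 \<le> box_ineq r x}"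
    by (auto simp: box_ineq_def split: if_splits)
  have hull: "?P = convex hull ?V"
  proof (rule inequalities_vertices(2)[OF _ affine_map_box_ineq affine_euclid_slice P_eq _ refl])
    fix x y assume xy: "x \<in> ?X" "y \<in> ?X" "x \<noteq> y"
    then obtain i where "lk x i \<noteq> lk y i" by (metis poly_mapping_eqI)
    moreover from this have "i < n" using xy by (metis (mono_tags, lifting) euclid_iff mem_Collect_eq not_less)
    ultimately have "box_ineq (i, lk x i < lk y i) x < box_ineq (i, lk x i < lk y i) y"
      "(i, lk x i < lk y i) \<in> ?R"
      by (auto simp: box_ineq_def)
    then show "\<exists>r\<in>?R. box_ineq r x < box_ineq r y" by blast
  qed simp
  have integral: "lk x i \<in> {0, 1}" if x: "x \<in> ?V" and i: "i < n" for x i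
  proof (rule ccontr)
    assume frac: "lk x i \<notin> {0, 1}"
    have xP: "x \<in> ?P" and min: "\<And>y. y \<in> ?P \<Longrightarrow> (\<forall>r\<in>?R. box_ineq r x = 0 \<longrightarrow> box_ineq r y = 0) \<Longrightarrow> y = x"
      using x by auto
    have "\<exists>j<n. j \<noteq> i \<and> lk x j \<notin> {0, 1}"
    proof (rule ccontr)
      assume no: "\<not> ?thesis"
      have "real k = lk x i + (\<Sum>j\<in>{..<n} - {i}. lk x j)"
        using xP i by (simp add: sum.remove)
      moreover have "(\<Sum>j\<in>{..<n} - {i}. lk x j) \<in> \<int>" using no by (intro Ints_sum) auto
      ultimately have "lk x i \<in> \<int>" by (metis Ints_diff Ints_of_nat add_diff_cancel_right')
      then obtain z where z: "lk x i = real_of_int z" by (auto elim: Ints_cases)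
      then have "0 \<le> z" "z \<le> 1" using xP i by auto
      then have "z = 0 \<or> z = 1" by linarith
      then show False using z frac by auto
    qed
    then obtain j where j: "j < n" "j \<noteq> i" "lk x j \<notin> {0, 1}" by blast
    have bounds: "0 < lk x i" "lk x i < 1" "0 < lk x j" "lk x j < 1"
      using xP i j frac by (auto simp: order_less_le)
    define e where "e = min (1 - lk x i) (lk x j)"
    have e: "0 < e" "e \<le> 1 - lk x i" "e \<le> lk x j" using bounds by (auto simp: e_def)
    define y where "y = x + (e / 2) *\<^sub>R (unit_vec i - unit_vec j)"
    have ly: "lk y l = lk x l + (if l = i then e / 2 else if l = j then - (e / 2) else 0)" for l
      using j(2) by (auto simp: y_def lookup_add lookup_minus lookup_single when_def)
    have "(\<Sum>l<n. if l = i then e / 2 else if l = j then - (e / 2) else 0) =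
        (\<Sum>l<n. (if l = i then e / 2 else 0)) - (\<Sum>l<n. (if l = j then e / 2 else 0))"
      using j(2) unfolding sum_subtractf[symmetric] by (intro sum.cong) auto
    also have "\<dots> = 0" using i j by simp
    finally have "(\<Sum>l<n. lk y l) = real k" using xP by (simp add: ly sum.distrib)
    then have "y \<in> ?P"
      using xP e bounds by (auto simp: ly euclid_iff i j not_le[symmetric])
    moreover have "box_ineq r y = 0" if "r \<in> ?R" "box_ineq r x = 0" for r
      using that bounds by (auto simp: box_ineq_def ly split: if_splits)
    ultimately have "y = x" using min by blast
    then show False using ly[of i] e by simp
  qed
  have "?V \<subseteq> {x \<in> euclid n. (\<forall>i<n. lk x i \<in> {0, 1}) \<and> (\<Sum>i<n. lk x i) = real k}"
    using integral by blast
  then have "convex hull ?V \<subseteq> hypersimplex n k"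
    unfolding hypersimplex_def by (rule hull_mono)
  then show "?P \<subseteq> hypersimplex n k" by (subst hull)
  have "convex ?P" by (subst hull) (rule convex_convex_hull)
  then show "hypersimplex n k \<subseteq> ?P"
    unfolding hypersimplex_def by (intro hull_minimal) auto
qed

lemma card_facets_hypersimplex: "card (facets (hypersimplex n k)) \<le> 2 * n"
proof -
  have "hypersimplex n k = {x \<in> {x \<in> euclid n. (\<Sum>i<n. lk x i) = real k}.
      \<forall>r\<in>{..<n} \<times> UNIV. 0 \<le> box_ineq r x}"
    unfolding hypersimplex_eq by (auto simp: box_ineq_def split: if_splits)
  then have "card (facets (hypersimplex n k)) \<le> card ({..<n} \<times> (UNIV :: bool set))"
    by (intro card_facets_le[OF polytope_hypersimplex _ affine_map_box_ineq affine_euclid_slice]) simp_all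
  then show ?thesis by (simp add: card_cartesian_product)
qed

lemma extension_ofI:
  assumes "polytope Q" "Q \<subseteq> euclid m" "affine_map f"
    and sub: "\<And>x. x \<in> Q \<Longrightarrow> f x \<in> hypersimplex n k"
    and vert: "\<And>v. v \<subseteq> {..<n} \<Longrightarrow> card v = k \<Longrightarrow> \<exists>x\<in>Q. f x = indicator_vec v"
  shows "extension_of Q (hypersimplex n k)"
proof -
  have "convex (f ` Q)"
  proof (rule convexI)
    fix x y u v assume "x \<in> f ` Q" "y \<in> f ` Q" and uv: "0 \<le> (u::real)" "0 \<le> v" "u + v = 1"
    then obtain p q where pq: "p \<in> Q" "q \<in> Q" "x = f p" "y = f q" by blast
    have "u *\<^sub>R p + v *\<^sub>R q \<in> Q"
      using convexD[OF polytope_imp_convex[OF assms(1)] pq(1,2) uv] .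
    then show "u *\<^sub>R x + v *\<^sub>R y \<in> f ` Q"
      unfolding pq(3,4) affine_map_comb[OF assms(3) uv(3), symmetric] by blast
  qed
  then have "hypersimplex n k \<subseteq> f ` Q"
    unfolding hypersimplex_indicator_vecs
    by (intro hull_minimal) (use vert in \<open>auto simp: image_iff eq_commute\<close>)
  then have "f ` Q = hypersimplex n k" using sub by blast
  then show ?thesis using assms(1-3) unfolding extension_of_def by blast
qed

text \<open>The rows are pulled back along \<open>f\<close> and expanded in slack functionals of the
  facets; the column of \<open>v\<close> is evaluated at an arbitrary preimage \<open>q v\<close>.
  Since \<open>1 <= k < n\<close>, every row vanishes somewhere, as the expansion requires.\<close>

lemma extension_slack_factorization:
  assumes ext: "extension_of Q (hypersimplex n k)" and k: "1 \<le> k" "k < n"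
  shows "\<exists>a b h. slack_factorization {..<n} k (facets Q) a b h"
proof -
  obtain f where Q: "polytope Q" and f: "affine_map f" "f ` Q = hypersimplex n k"
    using ext by (auto simp: extension_of_def)
  obtain s :: "(nat \<Rightarrow>\<^sub>0 real) set \<Rightarrow> (nat \<Rightarrow>\<^sub>0 real) \<Rightarrow> real"
    where s: "\<forall>F. \<forall>x\<in>Q. 0 \<le> s F x"
    "\<forall>g. affine_map g \<and> (\<forall>x\<in>Q. 0 \<le> g x) \<and> (\<exists>x\<in>Q. g x = 0) \<longrightarrow>
      (\<exists>c. (\<forall>F. 0 \<le> c F) \<and> (\<forall>x\<in>Q. g x = (\<Sum>F\<in>facets Q. c F * s F x)))"
    using polytope_slack_functionals[OF Q] by blast
  have vert: "\<exists>x\<in>Q. f x = indicator_vec v" if "v \<subseteq> {..<n}" "card v = k" for v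
    using indicator_vec_in_hypersimplex[OF that] f(2) by (metis imageE)
  define q where "q v = (SOME x. x \<in> Q \<and> f x = indicator_vec v)" for v
  have q: "q v \<in> Q" "f (q v) = indicator_vec v" if "v \<subseteq> {..<n}" "card v = k" for v
    using someI_ex[of "\<lambda>x. x \<in> Q \<and> f x = indicator_vec v"] vert[OF that] unfolding q_def by blast+
  have val: "lk (f (q v)) i = of_bool (i \<in> v)" if "v \<subseteq> {..<n}" "card v = k" for v i
    using q(2)[OF that] lookup_indicator_vec finite_subset[OF that(1)] by simp
  have box: "0 \<le> lk (f x) i \<and> lk (f x) i \<le> 1" if "x \<in> Q" "i < n" for x i
    using that f(2) hypersimplex_eq[of n k] by blast
  have zero0: "\<exists>x\<in>Q. lk (f x) i = 0" if i: "i < n" for i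
  proof -
    have "k \<le> card ({..<n} - {i})" using i k by simp
    then obtain t where t: "t \<subseteq> {..<n} - {i}" "card t = k"
      by (rule obtain_subset_with_card_n)
    then have "t \<subseteq> {..<n}" by blast
    then show ?thesis using q(1)[of t] val[of t i] t by (intro bexI[of _ "q t"]) auto
  qed
  have zero1: "\<exists>x\<in>Q. 1 - lk (f x) i = 0" if i: "i < n" for i
  proof -
    have "k - 1 \<le> card ({..<n} - {i})" using i k by simp
    then obtain t where t: "t \<subseteq> {..<n} - {i}" "card t = k - 1" "finite t"
      by (rule obtain_subset_with_card_n)
    then have "i \<notin> t" "insert i t \<subseteq> {..<n}" using i by auto
    moreover from this have "card (insert i t) = k" using t k by simp
    ultimately show ?thesis using q(1)[of "insert i t"] val[of "insert i t" i]
      by (intro bexI[of _ "q (insert i t)"]) auto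
  qed
  have aff: "affine_map (\<lambda>x. lk (f x) i)" for i
    using affine_map_compose[OF affine_map_lookup f(1)] .
  have "\<exists>c. (\<forall>F. 0 \<le> c F) \<and> (\<forall>x\<in>Q. lk (f x) i = (\<Sum>F\<in>facets Q. c F * s F x))" if i: "i < n" for i
    by (rule s(2)[rule_format]) (use aff box zero0 i in blast)
  then obtain a where a: "\<And>i F. i < n \<Longrightarrow> 0 \<le> a i F"
    "\<And>i x. i < n \<Longrightarrow> x \<in> Q \<Longrightarrow> lk (f x) i = (\<Sum>F\<in>facets Q. a i F * s F x)" by metis
  have "\<exists>c. (\<forall>F. 0 \<le> c F) \<and> (\<forall>x\<in>Q. 1 - lk (f x) i = (\<Sum>F\<in>facets Q. c F * s F x))" if i: "i < n" for i
    by (rule s(2)[rule_format]) (use affine_map_diff[OF affine_map_const aff] box zero1 i in simp)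
  then obtain b where b: "\<And>i F. i < n \<Longrightarrow> 0 \<le> b i F"
    "\<And>i x. i < n \<Longrightarrow> x \<in> Q \<Longrightarrow> 1 - lk (f x) i = (\<Sum>F\<in>facets Q. b i F * s F x)" by metis
  have "slack_factorization {..<n} k (facets Q) (\<lambda>F i. a i F) (\<lambda>F i. b i F) (\<lambda>F v. s F (q v))"
    unfolding slack_factorization_def
  proof (intro conjI ballI allI impI)
    show "finite (facets Q)" by (rule finite_facets[OF Q])
    fix v assume v: "v \<subseteq> {..<n}" "card v = k"
    { fix F show "0 \<le> s F (q v)" using s(1) q(1)[OF v] by blast }
    fix i assume i: "i \<in> {..<n}"
    show "(\<Sum>F\<in>facets Q. a i F * s F (q v)) = of_bool (i \<in> v)"
      using a(2)[of i "q v"] i q(1)[OF v] val[OF v] by simp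
    show "(\<Sum>F\<in>facets Q. b i F * s F (q v)) = of_bool (i \<notin> v)"
      using b(2)[of i "q v"] i q(1)[OF v] val[OF v, of i] by (cases "i \<in> v") auto
  qed (use a(1) b(1) in auto)
  then show ?thesis by blast
qed

lemma rk_plus_hypersimplex_ge:
  assumes "2 \<le> k" "k + 2 \<le> n"
  shows "hypersimplex_bound n \<le> rk_plus (hypersimplex n k)"
proof -
  obtain Q where Q: "extension_of Q (hypersimplex n k)" "card (facets Q) = rk_plus (hypersimplex n k)"
    using rk_plus_hypersimplex_attained by blast
  then obtain a b h where "slack_factorization {..<n} k (facets Q) a b h"
    using extension_slack_factorization[OF Q(1)] assms by auto
  from slack_factorization_bound[OF this assms(1)] show ?thesis using assms(2) Q(2) by simp
qed

section \<open>Upper bounds\<close>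

lemma rk_plus_le: "extension_of Q P \<Longrightarrow> card (facets Q) \<le> N \<Longrightarrow> rk_plus P \<le> N"
  unfolding rk_plus_def by (rule le_trans[OF Least_le]) auto

lemma rk_plus_hypersimplex_le: "rk_plus (hypersimplex n k) \<le> 2 * n"
proof (rule rk_plus_le[OF _ card_facets_hypersimplex])
  show "extension_of (hypersimplex n k) (hypersimplex n k)"
    unfolding extension_of_def using affine_map_linear[OF linear_id]
    by (intro conjI polytope_hypersimplex exI[of _ n] exI[of _ id] hypersimplex_subset_euclid) simp_all
qed

lemma less_numeral_cases:
  "(i::nat) < 4 \<Longrightarrow> i = 0 \<or> i = 1 \<or> i = 2 \<or> i = 3"
  "(i::nat) < 5 \<Longrightarrow> i = 0 \<or> i = 1 \<or> i = 2 \<or> i = 3 \<or> i = 4"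
  by linarith+

text \<open>A polytope is a projection of the simplex on its vertices. Here this simplex is
  \<open>hypersimplex 6 1\<close>, whose upper bounds follow from the other constraints, which
  leaves six inequalities.\<close>

lemma rk_plus_4_2_le: "rk_plus (hypersimplex 4 2) \<le> 6"
proof -
  define E :: "nat \<Rightarrow> nat set"
    where "E j = [{0,1}, {0,2}, {0,3}, {1,2}, {1,3}, {2,3}] ! j" for j
  define f where "f x = (\<Sum>j<6. lk x j *\<^sub>R indicator_vec (E j))" for x
  have E: "E j \<subseteq> {..<4} \<and> card (E j) = 2" if "j < 6" for j
  proof -
    have "j \<in> {0,1,2,3,4,5}" using that by auto
    then show ?thesis by (auto simp: E_def)
  qed
  have "linear f"
    unfolding f_def by (intro linear_compose_sum ballI linearI) (auto simp: lookup_add scaleR_left_distrib)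
  have eq: "hypersimplex 6 1 = {x \<in> {x \<in> euclid 6. (\<Sum>i<6. lk x i) = 1}. \<forall>i\<in>{..<6}. 0 \<le> lk x i}"
  proof -
    have "lk x i \<le> 1" if "i < 6" "\<forall>i\<in>{..<6}. 0 \<le> lk x i" "(\<Sum>i<6. lk x i) = 1" for x i
      using that member_le_sum[of i "{..<6}" "lk x"] by simp
    then show ?thesis unfolding hypersimplex_eq by auto
  qed
  have "card (facets (hypersimplex 6 1)) \<le> card {..<6::nat}"
    by (rule card_facets_le[OF polytope_hypersimplex _ affine_map_lookup affine_euclid_slice eq]) simp
  moreover have "extension_of (hypersimplex 6 1) (hypersimplex 4 2)"
  proof (rule extension_ofI[OF polytope_hypersimplex hypersimplex_subset_euclid affine_map_linear[OF \<open>linear f\<close>]])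
    fix x assume "x \<in> hypersimplex 6 1"
    then have "(\<Sum>i<6. lk x i) = 1" "\<forall>i<6. 0 \<le> lk x i" unfolding eq by auto
    then show "f x \<in> hypersimplex 4 2"
      unfolding f_def hypersimplex_indicator_vecs using E
      by (intro convex_sum convex_convex_hull) (auto simp: hull_inc)
  next
    fix v :: "nat set" assume v: "v \<subseteq> {..<4}" "card v = 2"
    then obtain p r where pr: "v = {p, r}" "p \<noteq> r" by (auto simp: card_2_iff)
    have "p < 4" "r < 4" using v(1) pr by auto
    from less_numeral_cases(1)[OF this(1)] less_numeral_cases(1)[OF this(2)]
    have "\<exists>j\<in>{0,1,2,3,4,5::nat}. v = E j" using pr(2) unfolding pr(1)
      by (elim disjE) (simp_all add: E_def insert_commute)
    then obtain j where j: "j \<in> {0,1,2,3,4,5}" "v = E j" by blast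
    have j6: "j < 6" using j(1) by auto
    have "f (unit_vec j) = (\<Sum>l<6. if l = j then indicator_vec (E j) else 0)"
      unfolding f_def by (intro sum.cong) (auto simp: lookup_single when_def)
    also have "\<dots> = indicator_vec v" using j(2) j6 by simp
    finally have "f (unit_vec j) = indicator_vec v" .
    moreover have "unit_vec j \<in> hypersimplex 6 1"
      using indicator_vec_in_hypersimplex[of "{j}" 6 1] j6 by (simp add: indicator_vec_def)
    ultimately show "\<exists>x\<in>hypersimplex 6 1. f x = indicator_vec v" by blast
  qed
  ultimately show ?thesis by (intro rk_plus_le) auto
qed

text \<open>The two extra coordinates, with indices 5 and 6, are the indicators of the vertices
  \<open>{0, 1}\<close> and \<open>{2, 3}\<close>. The two inequalities that mix them sum to \<open>x_4 \<ge> 0\<close>, which makes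
  nine inequalities suffice.\<close>

lemma rk_plus_5_2_le: "rk_plus (hypersimplex 5 2) \<le> 9"
proof -
  define l :: "nat \<Rightarrow> (nat \<Rightarrow>\<^sub>0 real) \<Rightarrow> real" where
    "l r x = [lk x 0 - lk x 5, lk x 1 - lk x 5, lk x 2 - lk x 6, lk x 3 - lk x 6, lk x 5, lk x 6,
      1 - lk x 0 - lk x 1 + lk x 5 - lk x 6, 1 - lk x 2 - lk x 3 + lk x 6 - lk x 5, 1 - lk x 4] ! r" for r x
  define X where "X = {x \<in> euclid 7. (\<Sum>i<5. lk x i) = 2}"
  define Q where "Q = {x \<in> X. \<forall>r\<in>{..<9}. 0 \<le> l r x}"
  define f where "f x = (\<Sum>i<5. lk x i *\<^sub>R unit_vec i)" for x
  have sum5: "(\<Sum>i<5. g i) = g 0 + g 1 + g 2 + g 3 + g 4" for g :: "nat \<Rightarrow> real"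
    by (simp add: eval_nat_numeral)
  have all9: "(\<forall>r\<in>{..<9}. P r) \<longleftrightarrow> P 0 \<and> P 1 \<and> P 2 \<and> P 3 \<and> P 4 \<and> P 5 \<and> P 6 \<and> P 7 \<and> P 8" for P :: "nat \<Rightarrow> bool"
    by (simp add: eval_nat_numeral lessThan_Suc conj_ac)
  have X: "affine X" unfolding X_def by (rule affine_euclid_slice)
  have aff: "affine_map (l r)" if "r \<in> {..<9}" for r
  proof -
    have "\<forall>r\<in>{..<9}. affine_map (l r)"
      unfolding all9 l_def
      by (simp, intro conjI affine_map_add affine_map_diff affine_map_const affine_map_lookup)
    then show ?thesis using that by blast
  qed
  \<comment> \<open>On \<open>X\<close> the functionals with indices 0, 1, 4, 5, 6 sum to 1, and so
    do 2, 3, 4, 5, 7 and also 6, 7, 8. So none can decrease without another one increasing, and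
    together they determine all coordinates.\<close>
  have pointed: "\<exists>r\<in>{..<9}. l r x < l r y" if xy: "x \<in> X" "y \<in> X" "x \<noteq> y" for x y
  proof (rule ccontr)
    assume "\<not> ?thesis"
    then have "\<forall>r\<in>{..<9}. l r y \<le> l r x" by force
    then have le: "lk y 0 - lk y 5 \<le> lk x 0 - lk x 5" "lk y 1 - lk y 5 \<le> lk x 1 - lk x 5"
      "lk y 2 - lk y 6 \<le> lk x 2 - lk x 6" "lk y 3 - lk y 6 \<le> lk x 3 - lk x 6" "lk y 5 \<le> lk x 5" "lk y 6 \<le> lk x 6"
      "1 - lk y 0 - lk y 1 + lk y 5 - lk y 6 \<le> 1 - lk x 0 - lk x 1 + lk x 5 - lk x 6"
      "1 - lk y 2 - lk y 3 + lk y 6 - lk y 5 \<le> 1 - lk x 2 - lk x 3 + lk x 6 - lk x 5"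
      "1 - lk y 4 \<le> 1 - lk x 4"
      unfolding all9 by (simp_all add: l_def)
    have sums: "lk x 0 + lk x 1 + lk x 2 + lk x 3 + lk x 4 = 2" "lk y 0 + lk y 1 + lk y 2 + lk y 3 + lk y 4 = 2"
      using xy(1,2) by (simp_all add: X_def sum5)
    have "lk x 5 = lk y 5" "lk x 6 = lk y 6" "lk x 0 = lk y 0" "lk x 1 = lk y 1"
      "lk x 2 = lk y 2" "lk x 3 = lk y 3" "lk x 4 = lk y 4"
      using le sums by linarith+
    moreover have "lk x i = lk y i" if "7 \<le> i" for i using that xy(1,2) by (simp add: X_def euclid_iff)
    moreover have "i = 0 \<or> i = 1 \<or> i = 2 \<or> i = 3 \<or> i = 4 \<or> i = 5 \<or> i = 6 \<or> 7 \<le> i" for i :: nat by linarith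
    ultimately have "x = y" by (intro poly_mapping_eqI) metis
    then show False using xy(3) by simp
  qed
  note vertices = inequalities_vertices[OF finite_lessThan aff X Q_def pointed refl]
  have poly: "polytope Q" unfolding polytope_def using vertices by blast
  have QE: "Q \<subseteq> euclid 7" by (auto simp: Q_def X_def)
  have "card (facets Q) \<le> card {..<9::nat}"
    by (rule card_facets_le[OF poly finite_lessThan aff X Q_def])
  moreover have lf: "lk (f x) i = (if i < 5 then lk x i else 0)" for x i
    by (auto simp: f_def lookup_sum lookup_single when_def if_distrib cong: if_cong)
  have "linear f"
    unfolding f_def by (intro linear_compose_sum ballI linearI) (auto simp: lookup_add scaleR_left_distrib)
  have "extension_of Q (hypersimplex 5 2)"
  proof (rule extension_ofI[OF poly QE affine_map_linear[OF \<open>linear f\<close>]])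
    fix x assume x: "x \<in> Q"
    then have le: "0 \<le> lk x 0 - lk x 5" "0 \<le> lk x 1 - lk x 5"
      "0 \<le> lk x 2 - lk x 6" "0 \<le> lk x 3 - lk x 6" "0 \<le> lk x 5" "0 \<le> lk x 6"
      "0 \<le> 1 - lk x 0 - lk x 1 + lk x 5 - lk x 6"
      "0 \<le> 1 - lk x 2 - lk x 3 + lk x 6 - lk x 5" "0 \<le> 1 - lk x 4"
      unfolding Q_def all9 by (simp_all add: l_def)
    have s: "lk x 0 + lk x 1 + lk x 2 + lk x 3 + lk x 4 = 2" using x by (simp add: Q_def X_def sum5)
    \<comment> \<open>For instance, \<open>x_0 <= 1\<close> follows from inequality 6 because
      \<open>x_1 - x_5\<close> and \<open>x_6\<close> are nonnegative.\<close>
    have "0 \<le> lk x 0" "lk x 0 \<le> 1" "0 \<le> lk x 1" "lk x 1 \<le> 1" "0 \<le> lk x 2" "lk x 2 \<le> 1"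
      "0 \<le> lk x 3" "lk x 3 \<le> 1" "0 \<le> lk x 4" "lk x 4 \<le> 1"
      using le s by linarith+
    then have "0 \<le> lk x i \<and> lk x i \<le> 1" if "i < 5" for i
      using less_numeral_cases(2)[OF that] by (elim disjE) simp_all
    then show "f x \<in> hypersimplex 5 2"
      unfolding hypersimplex_eq using s by (simp add: euclid_iff lf sum5)
  next
    fix v :: "nat set" assume v: "v \<subseteq> {..<5}" "card v = 2"
    then obtain p r where pr: "v = {p, r}" "p \<noteq> r" by (auto simp: card_2_iff)
    define x where "x = indicator_vec v + of_bool (v = {0, 1}) *\<^sub>R unit_vec 5 + of_bool (v = {2, 3}) *\<^sub>R unit_vec 6"
    have lx: "lk x i = of_bool (i \<in> v) + of_bool (v = {0, 1} \<and> i = 5) + of_bool (v = {2, 3} \<and> i = 6)" for i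
      using pr(1) by (simp add: x_def lookup_add lookup_indicator_vec lookup_single when_def)
    have "p < 5" "r < 5" using v(1) pr by auto
    from less_numeral_cases(2)[OF this(1)] less_numeral_cases(2)[OF this(2)]
    have "(\<Sum>i<5. lk x i) = 2 \<and> (\<forall>r\<in>{..<9}. 0 \<le> l r x)" using pr(2)
      unfolding sum5 all9 l_def lx pr(1) by (elim disjE) (simp_all add: doubleton_eq_iff)
    moreover have "x \<in> euclid 7"
      using v(1) by (auto simp: euclid_iff lx)
    ultimately have "x \<in> Q" by (simp add: Q_def X_def)
    moreover have "f x = indicator_vec v"
      using v(1) pr(1) by (intro poly_mapping_eqI) (auto simp: lf lx lookup_indicator_vec)
    ultimately show "\<exists>x\<in>Q. f x = indicator_vec v" by blast
  qed
  ultimately show ?thesis by (intro rk_plus_le) auto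
qed

lemma reflection_hypersimplex:
  assumes "k \<le> n"
  shows "(\<lambda>x. indicator_vec {..<n} - x) ` hypersimplex n k = hypersimplex n (n - k)"
proof -
  let ?c = "\<lambda>x. indicator_vec {..<n} - x"
  have sub: "?c x \<in> hypersimplex n (n - j)" if "j \<le> n" "x \<in> hypersimplex n j" for x j
    using that unfolding hypersimplex_eq
    by (auto simp: euclid_iff lookup_minus lookup_indicator_vec sum_subtractf of_nat_diff)
  have "x \<in> ?c ` hypersimplex n k" if "x \<in> hypersimplex n (n - k)" for x
  proof
    show "?c x \<in> hypersimplex n k" using sub[of "n - k" x] that assms by simp
  qed simp
  then show ?thesis using sub[OF assms] by blast
qed

lemma affine_map_reflection: "affine_map (\<lambda>x. c - x)"
  by (intro affine_map_diff affine_map_const affine_map_linear) (simp add: linear_iff)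

text \<open>The same extension serves both, with its projection followed by the reflection.\<close>

lemma rk_plus_complement_le:
  assumes "k \<le> n" shows "rk_plus (hypersimplex n (n - k)) \<le> rk_plus (hypersimplex n k)"
proof -
  obtain Q where Q: "extension_of Q (hypersimplex n k)" "card (facets Q) = rk_plus (hypersimplex n k)"
    using rk_plus_hypersimplex_attained by blast
  then obtain f where f: "affine_map f" "f ` Q = hypersimplex n k" by (auto simp: extension_of_def)
  have "(\<lambda>x. indicator_vec {..<n} - f x) ` Q = hypersimplex n (n - k)"
    using reflection_hypersimplex[OF assms] f(2) by (metis image_image)
  then have "extension_of Q (hypersimplex n (n - k))"
    using Q(1) affine_map_compose[OF affine_map_reflection f(1)] unfolding extension_of_def by blast
  then show ?thesis using Q(2) by (intro rk_plus_le) auto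
qed

theorem theorem1p1:
  shows "rk_plus (hypersimplex 4 2) = 6 \<and>
         hypersimplex 5 2 \<cong>\<^sub>a hypersimplex 5 3 \<and>
         rk_plus (hypersimplex 5 2) = 9 \<and>
         rk_plus (hypersimplex 5 3) = 9 \<and>
         (\<forall>n k. n \<ge> 6 \<and> 2 \<le> k \<and> k \<le> n - 2 \<longrightarrow> rk_plus (hypersimplex n k) = 2 * n)"
proof (intro conjI allI impI)
  show "rk_plus (hypersimplex 4 2) = 6"
    using rk_plus_4_2_le rk_plus_hypersimplex_ge[of 2 4] by (simp add: hypersimplex_bound_def)
  have "bij_betw (\<lambda>x. indicator_vec {..<5} - x) (hypersimplex 5 2) (hypersimplex 5 3)"
    using reflection_hypersimplex[of 2 5] by (simp add: bij_betw_def inj_on_def)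
  then show "hypersimplex 5 2 \<cong>\<^sub>a hypersimplex 5 3"
    unfolding affinely_isomorphic_def using affine_map_reflection by blast
  show "rk_plus (hypersimplex 5 2) = 9"
    using rk_plus_5_2_le rk_plus_hypersimplex_ge[of 2 5] by (simp add: hypersimplex_bound_def)
  show "rk_plus (hypersimplex 5 3) = 9"
    using rk_plus_5_2_le rk_plus_complement_le[of 2 5] rk_plus_hypersimplex_ge[of 3 5]
    by (simp add: hypersimplex_bound_def)
  fix n k :: nat assume nk: "6 \<le> n \<and> 2 \<le> k \<and> k \<le> n - 2"
  then have "k + 2 \<le> n" by linarith
  then have "2 * n \<le> rk_plus (hypersimplex n k)"
    using nk rk_plus_hypersimplex_ge[of k n] by (simp add: hypersimplex_bound_def)
  then show "rk_plus (hypersimplex n k) = 2 * n"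
    using rk_plus_hypersimplex_le[of n k] by simp
qed

end
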